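(* Let $r>0$, $1<p<n$, $0<q<p-1$, $0<\alpha<n/p$, and let $\sigma$ be a nonnegative locally finite Borel measure on $\mathbb{R}^n$. Suppose that $\sigma(E)\le C\,\mathrm{cap}_{\alpha,p}(E)$ for all compact $E\subset\mathbb{R}^n$, and $$\int_1^{\infty}\Big(\frac{\sigma(B(0,t))}{t^{n-\alpha p}}\Big)^{\frac1{p-1}}\frac{dt}{t}<\infty.$$ Then there exists a solution $u\in L^q_{\rm loc}(\mathbb{R}^n,d\sigma)$, $u>0$, of $$u=\mathbf{W}_{\alpha,p}(u^q\,d\sigma)+r\quad\text{in }\mathbb{R}^n$$ such that $$c^{-1}\Big(r+\big(\mathbf{W}_{\alpha,p}\sigma\big)^{\frac{p-1}{p-1-q}}\Big)\le u\le c\Big(r+\big(\mathbf{W}_{\alpha,p}\sigma\big)^{\frac{p-1}{p-1-q}}\Big),$$ with $c=c(n,p,q,\alpha,C,r)>0$. Moreover, $u\in L^s_{\rm loc}(\mathbb{R}^n,d\sigma)$ for every $s>0$.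
   Context: $\mathbf{W}_{\alpha,p}\mu(x)=\int_0^\infty\big(\mu(B(x,t))/t^{n-\alpha p}\big)^{\frac1{p-1}}\frac{dt}{t}$ is the Wolff potential; $u^q d\sigma$ is the measure with density $u^q$ w.r.t. $\sigma$. $\mathbf{I}_\alpha f(x)=\int_0^\infty\frac{\int_{B(x,r)}f\,dy}{r^{n-\alpha}}\frac{dr}{r}$ and $\mathrm{cap}_{\alpha,p}(E)=\inf\{\|f\|_{L^p}^p: f\ge0,\ f\in L^p(\mathbb{R}^n),\ \mathbf{I}_\alpha f\ge1\text{ on }E\}$. *)

theory Defs
  imports "HOL-Analysis.Analysis"
begin

text \<open>Real powers of extended nonnegative reals, for a positive exponent:
  \<open>\<infinity> ^ e = \<infinity>\<close>, otherwise the usual real power.\<close>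
definition enn_powr :: "ennreal \<Rightarrow> real \<Rightarrow> ennreal" (infixr "powe" 80) where
  "a powe e = (if a = top then top else ennreal (enn2real a powr e))"

definition wolff :: "real \<Rightarrow> real \<Rightarrow> 'a::euclidean_space measure \<Rightarrow> 'a \<Rightarrow> ennreal" where
  "wolff \<alpha> p \<mu> x =
     (\<integral>\<^sup>+ t. indicator {0<..} t *
        ((emeasure \<mu> (ball x t) / ennreal (t powr (real DIM('a) - \<alpha> * p))) powe (1 / (p - 1)))
        / ennreal t \<partial>lborel)"

definition riesz_pot :: "real \<Rightarrow> ('a::euclidean_space \<Rightarrow> real) \<Rightarrow> 'a \<Rightarrow> ennreal" where
  "riesz_pot \<alpha> f x =
     (\<integral>\<^sup>+ r. indicator {0<..} r *
        ((\<integral>\<^sup>+ y\<in>ball x r. ennreal (f y) \<partial>lborel) / ennreal (r powr (real DIM('a) - \<alpha>)))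
        / ennreal r \<partial>lborel)"

definition cap :: "real \<Rightarrow> real \<Rightarrow> 'a::euclidean_space set \<Rightarrow> ennreal" where
  "cap \<alpha> p E = (INF f \<in> {f. f \<in> borel_measurable lborel \<and> (\<forall>y. 0 \<le> f y)
        \<and> (\<integral>\<^sup>+ y. ennreal (f y powr p) \<partial>lborel) < \<infinity>
        \<and> (\<forall>x\<in>E. 1 \<le> riesz_pot \<alpha> f x)}.
      \<integral>\<^sup>+ y. ennreal (f y powr p) \<partial>lborel)"

end

theory Submission
  imports Defs
begin

text \<open>
  Discretise the Wolff potential over dyadic radii: up to constants it is the sum \<open>S\<close> over
  all integers \<open>k\<close> of \<open>a\<^sub>k(x) = (\<sigma>(B(x,2\<^sup>k)) 2\<^bsup>-kd\<^esup>)\<^sup>e\<close> with \<open>d = n - \<alpha>p\<close> and \<open>e = 1/(p-1)\<close>.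

  The capacity condition gives an energy bound. For a finite measure \<open>\<mu>\<close> take
  \<open>f\<^sup>p(y) = \<Sum>\<^sub>k (\<mu>(B(y,2\<^bsup>k+1\<^esup>)) 2\<^bsup>-k(n-\<alpha>)\<^esup>)\<^bsup>p/(p-1)\<^esup>\<close>. Then \<open>I\<^sub>\<alpha> f\<close> dominates \<open>S\<close> pointwise, while
  Fubini bounds the \<open>p\<close>-th power of the norm of \<open>f\<close> by \<open>\<integral> S d\<mu>\<close> (all sums being cut off at
  small scales, uniformly, to be finite). So \<open>\<mu>{S > t}\<close> is at most a constant times
  \<open>t\<^bsup>-p\<^esup> \<integral> S d\<mu>\<close>, and as \<open>p > 1\<close> this can be absorbed: \<open>\<integral> S d\<mu> \<le> A \<mu>(\<real>\<^sup>n)\<close>.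
  Applied to restrictions of \<open>\<sigma>\<close> to balls, and raised to higher powers by
  peeling off the largest scale and averaging, it controls all moments of the truncated
  potential on balls by the measure of a larger ball.

  The moment bounds make a multiple of \<open>r + S\<^sup>\<gamma>\<close>, where \<open>\<gamma> = (p-1)/(p-1-q)\<close>, a supersolution;
  the sublinearity \<open>q < p - 1\<close> is what allows the multiple to be chosen. Summation by parts makes
  \<open>r + \<epsilon> S\<^sup>\<gamma>\<close> a subsolution for small \<open>\<epsilon>\<close>, for any \<open>\<sigma>\<close>. Monotone iteration from the
  subsolution stays below the supersolution and converges to the required solution.
\<close>

section \<open>Extended nonnegative powers and sums over the integers\<close>

lemma powe_ennreal: "0 \<le> x \<Longrightarrow> ennreal x powe e = ennreal (x powr e)"
  by (simp add: enn_powr_def)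

lemma powe_top [simp]: "top powe e = top"
  by (simp add: enn_powr_def)

lemma powe_0 [simp]: "0 powe e = 0"
  by (simp add: enn_powr_def)

lemma powe_1 [simp]: "1 powe e = 1"
  using powe_ennreal[of 1 e] by simp

lemma powe_one_right [simp]: "a powe 1 = a"
  by (cases a) (auto simp: enn_powr_def)

lemma powe_mono: "a \<le> b \<Longrightarrow> 0 \<le> e \<Longrightarrow> a powe e \<le> b powe e"
  by (cases a; cases b) (auto simp: powe_ennreal powr_mono2 top_unique ennreal_le_iff)

lemma powe_eq_0_iff [simp]: "a powe e = 0 \<longleftrightarrow> a = 0"
  by (cases a) (auto simp: powe_ennreal ennreal_eq_0_iff enn_powr_def)

lemma powe_eq_top_iff [simp]: "a powe e = top \<longleftrightarrow> a = top"
  by (simp add: enn_powr_def)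

lemma powe_less_top: "a < top \<Longrightarrow> a powe e < top"
  using powe_eq_top_iff[of a e] by (simp add: less_top[symmetric])

text \<open>For every exponent the power sends 0 to 0 and \<infinity> to \<infinity>, so both sides
  follow the same convention 0 * \<infinity> = 0; the finite case is the real rule.\<close>

lemma powe_mult: "(a * b) powe e = a powe e * b powe e"
proof (cases "a = top \<or> b = top")
  case True
  then show ?thesis
    by (cases "a = 0"; cases "b = 0") (auto simp: ennreal_mult_top ennreal_top_mult)
next
  case False
  then obtain x y where "a = ennreal x" "0 \<le> x" "b = ennreal y" "0 \<le> y"
    by (metis ennreal_cases)
  then show ?thesis
    by (simp add: powe_ennreal powr_mult flip: ennreal_mult)
qed

lemma powe_powe: "(a powe e) powe f = a powe (e * f)"
  by (cases a) (auto simp: powe_ennreal powr_powr)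

lemma powe_plus: "a powe (e + f) = a powe e * a powe f"
  by (cases a) (auto simp: powe_ennreal powr_add ennreal_mult)

text \<open>For e > 0 the power has the monotone inverse with exponent 1/e, so it is an order
  isomorphism and preserves arbitrary suprema, empty ones included.\<close>

lemma powe_SUP:
  fixes f :: "'i \<Rightarrow> ennreal"
  assumes "0 < e"
  shows "(SUP i\<in>I. f i) powe e = (SUP i\<in>I. f i powe e)"
proof (rule antisym)
  let ?s = "SUP i\<in>I. f i powe e"
  have "f i \<le> ?s powe (1 / e)" if "i \<in> I" for i
  proof -
    have "(f i powe e) powe (1 / e) \<le> ?s powe (1 / e)"
      using assms that by (intro powe_mono SUP_upper) auto
    then show ?thesis using assms by (simp add: powe_powe)
  qed
  then have "(SUP i\<in>I. f i) \<le> ?s powe (1 / e)"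
    by (rule SUP_least)
  then have "(SUP i\<in>I. f i) powe e \<le> (?s powe (1 / e)) powe e"
    using assms by (intro powe_mono) auto
  then show "(SUP i\<in>I. f i) powe e \<le> ?s"
    using assms by (simp add: powe_powe)
  show "?s \<le> (SUP i\<in>I. f i) powe e"
    using assms by (intro SUP_least powe_mono SUP_upper) auto
qed

lemma borel_measurable_powe [measurable (raw)]:
  assumes [measurable]: "f \<in> borel_measurable M"
  shows "(\<lambda>x. f x powe e) \<in> borel_measurable M"
proof -
  have "(\<lambda>x. ennreal (enn2real (f x) powr e)) \<in> borel_measurable M"
    by measurable
  moreover have "{x \<in> space M. f x = top} \<in> sets M"
    by measurable
  ultimately show ?thesis
    unfolding enn_powr_def by (intro measurable_If) auto
qed

text \<open>Since a + b is at most twice the maximum, one constant serves both concave and convex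
  exponents.\<close>

lemma powe_add_le:
  assumes "0 \<le> e"
  shows "(a + b) powe e \<le> ennreal (2 powr e) * (a powe e + b powe e)"
proof -
  have "(a + b) powe e \<le> (ennreal 2 * max a b) powe e"
  proof (rule powe_mono[OF _ assms])
    have "a + b \<le> max a b + max a b" by (intro add_mono) auto
    then show "a + b \<le> ennreal 2 * max a b" by (simp add: mult_2)
  qed
  also have "\<dots> = ennreal (2 powr e) * max a b powe e"
    by (subst powe_mult, subst powe_ennreal) auto
  also have "\<dots> \<le> ennreal (2 powr e) * (a powe e + b powe e)"
    by (intro mult_left_mono) (auto simp: max_def)
  finally show ?thesis .
qed

text \<open>The term 1 covers a \<le> 1, the larger power covers a > 1. This reduces real exponents
  to integer ones and compares S with S^\<gamma>.\<close>

lemma powe_le_one_add: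
  assumes "0 < s" "s \<le> m"
  shows "a powe s \<le> 1 + a powe m"
proof (cases a)
  case (real x)
  have "x powr s \<le> 1 + x powr m"
  proof (cases "x \<le> 1")
    case True
    then have "x powr s \<le> 1" using assms real by (simp add: powr_le1)
    then show ?thesis by (smt (verit) powr_ge_zero)
  next
    case False
    then have "x powr s \<le> x powr m" using assms by (intro powr_mono) auto
    then show ?thesis by simp
  qed
  then have "ennreal (x powr s) \<le> ennreal (1 + x powr m)" by (rule ennreal_leI)
  then show ?thesis using real by (simp add: powe_ennreal)
qed auto

text \<open>Mean value theorem for the power \<beta> + 1, with the derivative bounded by its value
  at the right end point. It is the one-step inequality behind the summation by parts.\<close>

lemma powr_Suc_add_le:
  fixes s b \<beta> :: real
  assumes "0 \<le> s" "0 \<le> b" "0 < \<beta>"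
  shows "(s + b) powr (\<beta> + 1) \<le> s powr (\<beta> + 1) + (\<beta> + 1) * (b * (s + b) powr \<beta>)"
\<comment> \<open>The mean value theorem needs s > 0 for differentiability at the left end and b > 0
  for a proper interval.\<close>
proof (cases "s = 0 \<or> b = 0")
  case True
  then show ?thesis
    using assms by (cases "b = 0") (auto simp: powr_add algebra_simps)
next
  case False
  then have "0 < b" "0 < s" using assms by auto
  have "\<exists>z. s < z \<and> z < s + b \<and>
      (s + b) powr (\<beta> + 1) - s powr (\<beta> + 1) = (s + b - s) * ((\<beta> + 1) * z powr \<beta>)"
    using \<open>0 < b\<close> \<open>0 < s\<close>
    by (intro MVT2) (auto intro!: derivative_eq_intros)
  then obtain z where z: "s < z" "z < s + b"
    "(s + b) powr (\<beta> + 1) - s powr (\<beta> + 1) = b * ((\<beta> + 1) * z powr \<beta>)" by auto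
  have "z powr \<beta> \<le> (s + b) powr \<beta>" using z assms by (intro powr_mono2) auto
  then have "b * ((\<beta> + 1) * z powr \<beta>) \<le> b * ((\<beta> + 1) * (s + b) powr \<beta>)"
    using assms by (intro mult_left_mono) auto
  then show ?thesis using z by (simp add: algebra_simps)
qed

lemma powe_Suc_add_le:
  assumes "0 < \<beta>"
  shows "(s + b) powe (\<beta> + 1) \<le> s powe (\<beta> + 1) + ennreal (\<beta> + 1) * (b * (s + b) powe \<beta>)"
proof (cases "s = top \<or> b = top")
  case True
  then show ?thesis using assms
    by (auto simp: ennreal_mult_top ennreal_top_mult ennreal_eq_0_iff)
next
  case False
  then obtain x y where xy: "s = ennreal x" "0 \<le> x" "b = ennreal y" "0 \<le> y"
    by (metis ennreal_cases)
  have "ennreal ((x + y) powr (\<beta> + 1))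
      \<le> ennreal (x powr (\<beta> + 1) + (\<beta> + 1) * (y * (x + y) powr \<beta>))"
    using powr_Suc_add_le[of x y \<beta>] xy assms by (intro ennreal_leI) auto
  also have "\<dots> = ennreal x powe (\<beta> + 1) + ennreal (\<beta> + 1) * (ennreal y * ennreal (x + y) powe \<beta>)"
    using xy assms by (simp add: powe_ennreal ennreal_mult del: ennreal_plus)
      (simp add: ennreal_mult)
  finally show ?thesis using xy by (simp add: powe_ennreal flip: ennreal_plus)
qed

section \<open>Sums over all dyadic scales, as integrals against counting measure\<close>

abbreviation zsum :: "(int \<Rightarrow> ennreal) \<Rightarrow> ennreal" where
  "zsum f \<equiv> \<integral>\<^sup>+ k. f k \<partial>count_space UNIV"

lemma zsum_shift: "zsum (\<lambda>k. f (k + c)) = zsum f"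
  by (rule nn_integral_bij_count_space[of "\<lambda>k. k + c"])
     (auto intro!: bij_betwI[where g = "\<lambda>k. k - c"])

lemma zsum_uminus: "zsum (\<lambda>k. f (- k)) = zsum f"
  by (rule nn_integral_bij_count_space[of "\<lambda>k. - k"])
     (auto intro!: bij_betwI[where g = "\<lambda>k. - k"])

lemma zsum_mono: "(\<And>k. f k \<le> g k) \<Longrightarrow> zsum f \<le> zsum g"
  by (rule nn_integral_mono) auto

lemma zsum_cmult: "zsum (\<lambda>k. c * f k) = c * zsum f"
  by (rule nn_integral_cmult) auto

lemma zsum_add: "zsum (\<lambda>k. f k + g k) = zsum f + zsum g"
  by (rule nn_integral_add) auto

lemma zsum_ge_sum:
  assumes "finite F"
  shows "sum f F \<le> zsum f"
proof -
  have "sum f F = (\<integral>\<^sup>+ k. f k \<partial>count_space F)"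
    using assms by (simp add: nn_integral_count_space_finite)
  also have "\<dots> = zsum (\<lambda>k. f k * indicator F k)"
    by (simp add: nn_integral_count_space_indicator)
  also have "\<dots> \<le> zsum f"
    by (rule zsum_mono) (auto simp: indicator_def)
  finally show ?thesis .
qed

lemma zsum_ge: "f k \<le> zsum f"
  using zsum_ge_sum[of "{k}" f] by simp

text \<open>Enumerating the integers by \<open>int_decode\<close> turns the sum into a series, so
  the interchange holds over any measure space.\<close>

lemma zsum_swap:
  assumes "\<And>k. f k \<in> borel_measurable M"
  shows "(\<integral>\<^sup>+ x. zsum (\<lambda>k. f k x) \<partial>M) = zsum (\<lambda>k. \<integral>\<^sup>+ x. f k x \<partial>M)"
proof -
  have *: "zsum g = (\<Sum>i. g (int_decode i))" for g
  proof -
    have "zsum g = (\<integral>\<^sup>+ i. g (int_decode i) \<partial>count_space UNIV)"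
      by (rule nn_integral_bij_count_space[symmetric]) (rule bij_int_decode)
    then show ?thesis by (simp add: nn_integral_count_space_nat)
  qed
  show ?thesis unfolding *
    by (rule nn_integral_suminf) (use assms in auto)
qed

text \<open>Symmetric finite windows exhaust the integers; inequalities proved for finite sums pass
  to the full sum through this supremum.\<close>

lemma zsum_SUP_sum: "zsum f = (SUP n. sum f {- int n..int n})"
proof -
  have "zsum f = zsum (\<lambda>k. SUP n. f k * indicator {- int n..int n} k)"
  proof (intro nn_integral_cong antisym)
    fix k :: int
    have "f k = f k * indicator {- int (nat \<bar>k\<bar>)..int (nat \<bar>k\<bar>)} k"
      by (simp add: indicator_def) linarith
    also have "\<dots> \<le> (SUP n. f k * indicator {- int n..int n} k)"
      by (rule SUP_upper) auto
    finally show "f k \<le> (SUP n. f k * indicator {- int n..int n} k)" .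
    show "(SUP n. f k * indicator {- int n..int n} k) \<le> f k"
      by (rule SUP_least) (auto simp: indicator_def)
  qed
  also have "\<dots> = (SUP n. zsum (\<lambda>k. f k * indicator {- int n..int n} k))"
    by (rule nn_integral_monotone_convergence_SUP)
       (auto simp: incseq_def le_fun_def indicator_def)
  also have "\<dots> = (SUP n. sum f {- int n..int n})"
    by (simp flip: nn_integral_count_space_indicator add: nn_integral_count_space_finite)
  finally show ?thesis .
qed

text \<open>Summation by parts for the power \<open>\<beta> + 1\<close>: it replaces integrating
  \<open>F\<^sup>\<beta> dF\<close>.\<close>

lemma sum_powe_le:
  fixes b :: "int \<Rightarrow> ennreal"
  assumes "0 < \<beta>" "finite F"
  shows "(sum b F) powe (\<beta> + 1)
     \<le> ennreal (\<beta> + 1) * (\<Sum>k\<in>F. b k * (\<Sum>j\<in>F \<inter> {..k}. b j) powe \<beta>)"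
  using assms(2)
proof (induction F rule: finite_linorder_max_induct)
  case (insert m F)
  have m: "m \<notin> F" using insert by auto
  \<comment> \<open>Indices enter in increasing order: the new maximum m leaves the partial sums at
    earlier indices unchanged, and the partial sum at m is the whole sum.\<close>
  have 1: "insert m F \<inter> {..k} = F \<inter> {..k}" if "k \<in> F" for k
    using insert that by auto
  have 2: "insert m F \<inter> {..m} = insert m F"
    using insert by auto
  have "(sum b (insert m F)) powe (\<beta> + 1) = (sum b F + b m) powe (\<beta> + 1)"
    using insert m by (simp add: add.commute)
  also have "\<dots> \<le> (sum b F) powe (\<beta> + 1) + ennreal (\<beta> + 1) * (b m * (sum b F + b m) powe \<beta>)"
    by (rule powe_Suc_add_le[OF assms(1)])
  also have "\<dots> \<le> ennreal (\<beta> + 1) * (\<Sum>k\<in>F. b k * (\<Sum>j\<in>F \<inter> {..k}. b j) powe \<beta>)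
      + ennreal (\<beta> + 1) * (b m * (sum b F + b m) powe \<beta>)"
    using insert by (intro add_mono) auto
  also have "\<dots> = ennreal (\<beta> + 1) * (\<Sum>k\<in>insert m F. b k * (\<Sum>j\<in>insert m F \<inter> {..k}. b j) powe \<beta>)"
    using insert.hyps(1) m by (simp add: 1 2 distrib_left add.commute)
  finally show ?case .
qed simp

lemma zsum_powe_le:
  fixes b :: "int \<Rightarrow> ennreal"
  assumes "0 < \<beta>"
  shows "(zsum b) powe (\<beta> + 1)
     \<le> ennreal (\<beta> + 1) * zsum (\<lambda>k. b k * zsum (\<lambda>j. b j * indicator {..k} j) powe \<beta>)"
proof -
  have "(sum b {- int n..int n}) powe (\<beta> + 1)
     \<le> ennreal (\<beta> + 1) * zsum (\<lambda>k. b k * zsum (\<lambda>j. b j * indicator {..k} j) powe \<beta>)" for n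
  proof -
    let ?F = "{- int n..int n}"
    have "(\<Sum>j\<in>?F \<inter> {..k}. b j) \<le> zsum (\<lambda>j. b j * indicator {..k} j)" for k
    proof -
      have "(\<Sum>j\<in>?F \<inter> {..k}. b j) = (\<Sum>j\<in>?F \<inter> {..k}. b j * indicator {..k} j)"
        by (intro sum.cong) auto
      then show ?thesis using zsum_ge_sum[of "?F \<inter> {..k}" "\<lambda>j. b j * indicator {..k} j"] by simp
    qed
    then have "(\<Sum>k\<in>?F. b k * (\<Sum>j\<in>?F \<inter> {..k}. b j) powe \<beta>)
        \<le> (\<Sum>k\<in>?F. b k * zsum (\<lambda>j. b j * indicator {..k} j) powe \<beta>)"
      using assms by (intro sum_mono mult_left_mono powe_mono) (blast, simp_all)
    also have "\<dots> \<le> zsum (\<lambda>k. b k * zsum (\<lambda>j. b j * indicator {..k} j) powe \<beta>)"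
      by (rule zsum_ge_sum) simp
    finally show ?thesis
      using sum_powe_le[OF assms, of ?F b] by (meson finite_atLeastAtMost_int mult_left_mono order_trans zero_le)
  qed
  then have "(SUP n. (sum b {- int n..int n}) powe (\<beta> + 1))
     \<le> ennreal (\<beta> + 1) * zsum (\<lambda>k. b k * zsum (\<lambda>j. b j * indicator {..k} j) powe \<beta>)"
    by (intro SUP_least)
  then show ?thesis using assms
    by (simp add: zsum_SUP_sum[of b] powe_SUP)
qed

text \<open>The reflection k -> -k exchanges partial sums from below with partial sums from
  above.\<close>

lemma zsum_powe_le_up:
  fixes b :: "int \<Rightarrow> ennreal"
  assumes "0 < \<beta>"
  shows "(zsum b) powe (\<beta> + 1)
     \<le> ennreal (\<beta> + 1) * zsum (\<lambda>k. b k * zsum (\<lambda>j. b j * indicator {k..} j) powe \<beta>)"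
proof -
  have *: "zsum (\<lambda>j. b (- j) * indicator {..k} j) = zsum (\<lambda>j. b j * indicator {- k..} j)" for k
  proof -
    have "zsum (\<lambda>j. b (- j) * indicator {..k} j) = zsum (\<lambda>j. b (- j) * indicator {- k..} (- j))"
      by (intro nn_integral_cong) (auto simp: indicator_def)
    then show ?thesis using zsum_uminus[of "\<lambda>j. b j * indicator {- k..} j"] by simp
  qed
  show ?thesis
    using zsum_powe_le[OF assms, of "\<lambda>k. b (- k)"]
    by (simp add: * zsum_uminus zsum_uminus[of "\<lambda>k. b k * zsum (\<lambda>j. b j * indicator {k..} j) powe \<beta>"])
qed

text \<open>For a finite measure all ball masses are bounded, so this series is what makes
  potentials cut off at small scales finite.\<close>

lemma zsum_geometric_finite:
  fixes b :: real and N :: int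
  assumes "0 < b"
  shows "zsum (\<lambda>k. ennreal (2 powr (- (b * k))) * indicator {N..} k) < top"
proof -
  have "zsum (\<lambda>k. ennreal (2 powr (- (b * k))) * indicator {N..} k)
      = (\<integral>\<^sup>+ k. ennreal (2 powr (- (b * k))) \<partial>count_space {N..})"
    by (simp add: nn_integral_count_space_indicator)
  also have "\<dots> = (\<integral>\<^sup>+ i. ennreal (2 powr (- (b * (N + int i)))) \<partial>count_space UNIV)"
    by (rule nn_integral_bij_count_space[symmetric, of "\<lambda>i. N + int i"])
       (auto intro!: bij_betwI[where g = "\<lambda>k. nat (k - N)"])
  also have "\<dots> = (\<Sum>i. ennreal (2 powr (- (b * N)) * (2 powr (- b)) ^ i))"
    by (subst nn_integral_count_space_nat)
       (simp add: powr_powr flip: powr_realpow powr_add, simp add: algebra_simps)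
  also have "\<dots> < top"
  proof -
    have "summable (\<lambda>i. 2 powr (- (b * N)) * (2 powr (- b)) ^ i)"
      using assms by (intro summable_mult summable_geometric) (auto simp: powr_less_one)
    then show ?thesis by (subst suminf_ennreal2) (auto simp: less_top)
  qed
  finally show ?thesis .
qed

section \<open>Dyadic form of the Wolff potential\<close>

text \<open>The sets where a monotone function is below a level are intervals. Applied to the mass
  of a ball as a function of its radius.\<close>

lemma borel_measurable_mono_ennreal:
  fixes f :: "real \<Rightarrow> ennreal"
  assumes "mono f"
  shows "f \<in> borel_measurable borel"
proof (rule borel_measurableI_less)
  fix y
  have "is_interval {x. f x < y}"
    unfolding is_interval_1 using assms by (auto dest: monoD intro: le_less_trans)
  then have "{x. f x < y} \<in> sets borel"
    by (rule real_interval_borel_measurable)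
  then show "{x \<in> space borel. f x < y} \<in> sets borel" by simp
qed

lemma zsum_dyadic_indicator:
  fixes t :: real
  shows "zsum (\<lambda>k. a * indicator {2 powr k<..2 powr (k + 1)} t) = indicator {0<..} t * a"
proof (cases "0 < t")
  case True
  \<comment> \<open>The shells are open on the left and closed on the right, hence the ceiling minus
    one: k0 is the unique integer with k0 < log 2 t \<le> k0 + 1.\<close>
  define k0 where "k0 = \<lceil>log 2 t\<rceil> - 1"
  have "t \<in> {2 powr k<..2 powr (k + 1)} \<longleftrightarrow> k = k0" for k :: int
  proof -
    have "t \<in> {2 powr k<..2 powr (k + 1)} \<longleftrightarrow> real_of_int k < log 2 t \<and> log 2 t \<le> real_of_int k + 1"
      using True by (simp add: less_log_iff log_le_iff)
    also have "\<dots> \<longleftrightarrow> k = k0" unfolding k0_def by linarith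
    finally show ?thesis .
  qed
  then have "zsum (\<lambda>k. a * indicator {2 powr k<..2 powr (k + 1)} t)
      = zsum (\<lambda>k. a * indicator {k0} k)"
    by (intro nn_integral_cong) (auto simp: indicator_def)
  also have "\<dots> = a"
    by (simp flip: nn_integral_count_space_indicator add: nn_integral_count_space_finite)
  finally show ?thesis using True by simp
next
  case False
  have "t \<notin> {2 powr k<..2 powr (k + 1)}" for k :: int
    using False powr_gt_zero[of 2 "real_of_int k"] by (auto simp del: powr_gt_zero)
  then have "zsum (\<lambda>k. a * indicator {2 powr k<..2 powr (k + 1)} t) = zsum (\<lambda>k. 0)"
    by (intro nn_integral_cong) auto
  then show ?thesis using False by simp
qed

lemma nn_integral_dyadic:
  fixes G :: "real \<Rightarrow> ennreal"
  assumes [measurable]: "G \<in> borel_measurable borel"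
  shows "(\<integral>\<^sup>+ t. indicator {0<..} t * G t \<partial>lborel)
    = zsum (\<lambda>k. \<integral>\<^sup>+ t. G t * indicator {2 powr k<..2 powr (k + 1)} t \<partial>lborel)"
  by (subst zsum_swap[symmetric]) (auto simp: zsum_dyadic_indicator)

lemma dyadic_cmult_integral:
  fixes k :: int
  shows "(\<integral>\<^sup>+ t. c * indicator {2 powr k<..2 powr (k + 1)} t \<partial>lborel) = c * ennreal (2 powr k)"
  by (subst nn_integral_cmult_indicator) (auto simp: powr_add)

lemma nn_integral_dyadic_ge:
  fixes G :: "real \<Rightarrow> ennreal" and c :: "int \<Rightarrow> ennreal"
  assumes "G \<in> borel_measurable borel"
    and "\<And>k t. 2 powr k < t \<Longrightarrow> t \<le> 2 powr (k + 1) \<Longrightarrow> c k \<le> G t"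
  shows "zsum (\<lambda>k. c k * ennreal (2 powr k)) \<le> (\<integral>\<^sup>+ t. indicator {0<..} t * G t \<partial>lborel)"
  unfolding nn_integral_dyadic[OF assms(1)] dyadic_cmult_integral[symmetric]
  by (intro zsum_mono nn_integral_mono) (auto simp: indicator_def assms(2))

lemma nn_integral_dyadic_le:
  fixes G :: "real \<Rightarrow> ennreal" and c :: "int \<Rightarrow> ennreal"
  assumes "G \<in> borel_measurable borel"
    and "\<And>k t. 2 powr k < t \<Longrightarrow> t \<le> 2 powr (k + 1) \<Longrightarrow> G t \<le> c k"
  shows "(\<integral>\<^sup>+ t. indicator {0<..} t * G t \<partial>lborel) \<le> zsum (\<lambda>k. c k * ennreal (2 powr k))"
  unfolding nn_integral_dyadic[OF assms(1)] dyadic_cmult_integral[symmetric]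
  by (intro zsum_mono nn_integral_mono) (auto simp: indicator_def assms(2))

definition dterm :: "real \<Rightarrow> real \<Rightarrow> 'a::euclidean_space measure \<Rightarrow> int \<Rightarrow> 'a \<Rightarrow> ennreal" where
  "dterm d e M k x = (emeasure M (ball x (2 powr k)) * ennreal (2 powr (- (d * k)))) powe e"

abbreviation dpot :: "real \<Rightarrow> real \<Rightarrow> 'a::euclidean_space measure \<Rightarrow> 'a \<Rightarrow> ennreal" where
  "dpot d e M x \<equiv> zsum (\<lambda>k. dterm d e M k x)"

lemma dterm_eq:
  "dterm d e M k x = emeasure M (ball x (2 powr k)) powe e * ennreal (2 powr (- (d * k * e)))"
  by (simp add: dterm_def powe_mult powe_ennreal powr_powr)

lemma divide_powr_ennreal: "0 < t \<Longrightarrow> a / ennreal (t powr d) = a * ennreal (t powr (- d))"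
  by (simp add: divide_ennreal_def inverse_ennreal powr_minus)

lemma divide_ennreal_pos: "0 < t \<Longrightarrow> a / ennreal t = a * ennreal (t powr (- 1))"
  using divide_powr_ennreal[of t a 1] by simp

text \<open>The integrand of the Wolff potential with abstract exponents, without the cutoff to
  positive radii.\<close>

definition wkern :: "real \<Rightarrow> real \<Rightarrow> 'a::euclidean_space measure \<Rightarrow> 'a \<Rightarrow> real \<Rightarrow> ennreal" where
  "wkern d e M x t = (emeasure M (ball x t) / ennreal (t powr d)) powe e / ennreal t"

lemma borel_measurable_emeasure_ball_radius:
  assumes "sets M = sets borel"
  shows "(\<lambda>t. emeasure M (ball x t)) \<in> borel_measurable borel"
  by (intro borel_measurable_mono_ennreal monoI emeasure_mono) (auto simp: assms)

lemma borel_measurable_wkern: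
  assumes "sets M = sets borel"
  shows "wkern d e M x \<in> borel_measurable borel"
proof -
  note [measurable] = borel_measurable_emeasure_ball_radius[OF assms]
  show ?thesis unfolding wkern_def by measurable
qed

lemma wkern_eq:
  assumes "0 < t"
  shows "wkern d e M x t = emeasure M (ball x t) powe e * ennreal (t powr (- d * e) * t powr (- 1))"
  unfolding wkern_def divide_powr_ennreal[OF assms] divide_ennreal_pos[OF assms] powe_mult
  by (simp only: powe_ennreal powr_ge_zero powr_powr ennreal_mult mult.assoc)

text \<open>On the shell the mass is at least that of the inner ball, and t^(-de) and 1/t are at
  least their values at the outer radius; this costs 2^(-(1+de)). The factor 2^(-k) cancels against
  the length of the shell.\<close>

lemma wkern_ge:
  fixes k :: int
  assumes "sets M = sets borel" "0 < d" "0 < e" "2 powr k < t" "t \<le> 2 powr (k + 1)"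
  shows "ennreal (2 powr (- (1 + d * e))) * dterm d e M k x * ennreal (2 powr (- k)) \<le> wkern d e M x t"
proof -
  have t: "0 < t" using assms(4) powr_gt_zero[of 2 "real_of_int k"] by linarith
  have "ennreal (2 powr (- (1 + d * e))) * dterm d e M k x * ennreal (2 powr (- k))
      = emeasure M (ball x (2 powr k)) powe e *
        (ennreal (2 powr (- (d * k * e))) * ennreal (2 powr (- (1 + d * e))) * ennreal (2 powr (- k)))"
    by (simp add: dterm_eq mult_ac)
  also have "\<dots> = emeasure M (ball x (2 powr k)) powe e *
        ennreal (2 powr ((k + 1) * (- d) * e) * 2 powr ((k + 1) * (- 1)))"
  proof -
    have "- (d * k * e) + - (1 + d * e) + - k = (k + 1) * (- d) * e + (k + 1) * (- 1)"
      by (simp add: algebra_simps)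
    then show ?thesis by (simp only: powr_ge_zero of_int_minus flip: ennreal_mult powr_add)
  qed
  also have "\<dots> \<le> emeasure M (ball x t) powe e * ennreal (t powr (- d * e) * t powr (- 1))"
  proof (intro mult_mono powe_mono emeasure_mono ennreal_leI)
    have "2 powr ((k + 1) * (- d) * e) = (2 powr (k + 1)) powr (- d * e)"
      by (simp add: powr_powr mult.assoc)
    also have "\<dots> \<le> t powr (- d * e)"
      using assms t by (intro powr_mono2') auto
    finally show "2 powr ((k + 1) * (- d) * e) \<le> t powr (- d * e)" .
    have "2 powr ((k + 1) * (- 1)) = (2 powr (k + 1)) powr (- 1)"
      unfolding powr_powr by simp
    also have "\<dots> \<le> t powr (- 1)"
      using assms t by (intro powr_mono2') auto
    finally show "2 powr ((k + 1) * (- 1)) \<le> t powr (- 1)" .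
  qed (use assms in \<open>auto\<close>)
  also have "\<dots> = wkern d e M x t"
    by (rule wkern_eq[OF t, symmetric])
  finally show ?thesis .
qed

text \<open>Here the ball grows to the outer radius while the powers of t are taken at the inner
  one. The scale moves to k + 1, which a sum over all integers does not notice.\<close>

lemma wkern_le:
  fixes k :: int
  assumes "sets M = sets borel" "0 < d" "0 < e" "2 powr k < t" "t \<le> 2 powr (k + 1)"
  shows "wkern d e M x t \<le> ennreal (2 powr (d * e)) * dterm d e M (k + 1) x * ennreal (2 powr (- k))"
proof -
  have t: "0 < t" using assms(4) powr_gt_zero[of 2 "real_of_int k"] by linarith
  have "wkern d e M x t = emeasure M (ball x t) powe e * ennreal (t powr (- d * e) * t powr (- 1))"
    by (rule wkern_eq[OF t])
  also have "\<dots> \<le> emeasure M (ball x (2 powr (k + 1))) powe e *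
        ennreal (2 powr (k * (- d) * e) * 2 powr (k * (- 1)))"
  proof (intro mult_mono powe_mono emeasure_mono ennreal_leI)
    have "t powr (- d * e) \<le> (2 powr k) powr (- d * e)"
      using assms t by (intro powr_mono2') auto
    then show "t powr (- d * e) \<le> 2 powr (k * (- d) * e)"
      by (simp add: powr_powr mult.assoc)
    have "t powr (- 1) \<le> (2 powr k) powr (- 1)"
      using assms t by (intro powr_mono2') auto
    then show "t powr (- 1) \<le> 2 powr (k * (- 1))"
      unfolding powr_powr by simp
  qed (use assms in \<open>auto\<close>)
  also have "\<dots> = emeasure M (ball x (2 powr (k + 1))) powe e *
        (ennreal (2 powr (- (d * (k + 1) * e))) * ennreal (2 powr (d * e)) * ennreal (2 powr (- k)))"
  proof -
    have "k * (- d) * e + k * (- 1) = - (d * (k + 1) * e) + d * e + - k"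
      by (simp add: algebra_simps)
    then show ?thesis
      by (simp only: powr_ge_zero of_int_minus of_int_add of_int_1 flip: ennreal_mult powr_add)
  qed
  also have "\<dots> = ennreal (2 powr (d * e)) * dterm d e M (k + 1) x * ennreal (2 powr (- k))"
    by (simp add: dterm_eq mult_ac)
  finally show ?thesis .
qed

lemma powr_inverse_cancel:
  fixes k :: int
  shows "a * ennreal (2 powr (- k)) * ennreal (2 powr k) = a"
  by (simp add: mult.assoc flip: ennreal_mult powr_add)

lemma wolff_eq:
  fixes M :: "'a::euclidean_space measure"
  shows "wolff \<alpha> p M x = (\<integral>\<^sup>+ t. indicator {0<..} t *
     wkern (real DIM('a) - \<alpha> * p) (1 / (p - 1)) M x t \<partial>lborel)"
  unfolding wolff_def wkern_def
  by (intro nn_integral_cong) (simp add: indicator_def)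

lemma wolff_ge_dpot:
  fixes M :: "'a::euclidean_space measure"
  assumes M: "sets M = sets borel"
    and d: "d = real DIM('a) - \<alpha> * p" "0 < d" and e: "e = 1 / (p - 1)" "0 < e"
  shows "ennreal (2 powr (- (1 + d * e))) * dpot d e M x \<le> wolff \<alpha> p M x"
  using nn_integral_dyadic_ge[OF borel_measurable_wkern[OF M],
      where c = "\<lambda>k. ennreal (2 powr (- (1 + d * e))) * dterm d e M k x * ennreal (2 powr (- k))",
      OF wkern_ge[OF M d(2) e(2)]]
  unfolding wolff_eq d(1)[symmetric] e(1)[symmetric] powr_inverse_cancel zsum_cmult .

lemma wolff_le_dpot:
  fixes M :: "'a::euclidean_space measure"
  assumes M: "sets M = sets borel"
    and d: "d = real DIM('a) - \<alpha> * p" "0 < d" and e: "e = 1 / (p - 1)" "0 < e"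
  shows "wolff \<alpha> p M x \<le> ennreal (2 powr (d * e)) * dpot d e M x"
  using nn_integral_dyadic_le[OF borel_measurable_wkern[OF M],
      where c = "\<lambda>k. ennreal (2 powr (d * e)) * dterm d e M (k + 1) x * ennreal (2 powr (- k))",
      OF wkern_le[OF M d(2) e(2)]]
  unfolding wolff_eq d(1)[symmetric] e(1)[symmetric] powr_inverse_cancel zsum_cmult zsum_shift[of "\<lambda>k. dterm d e M k x"] .

text \<open>The shells with index k \<ge> 0 lie in [1, \<infinity>), so the integrability condition
  at infinity controls exactly the scales k \<ge> 0.\<close>

lemma tail_dpot_le:
  fixes M :: "'a::euclidean_space measure"
  assumes M: "sets M = sets borel" and d: "0 < d" and e: "0 < e"
  shows "ennreal (2 powr (- (1 + d * e))) * zsum (\<lambda>k. dterm d e M k x * indicator {0..} k)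
    \<le> (\<integral>\<^sup>+ t. indicator {1..} t * wkern d e M x t \<partial>lborel)"
proof -
  have [measurable]: "wkern d e M x \<in> borel_measurable borel"
    by (rule borel_measurable_wkern[OF M])
  let ?G = "\<lambda>t. indicator {1..} t * wkern d e M x t"
  let ?c = "\<lambda>k::int. ennreal (2 powr (- (1 + d * e))) * (dterm d e M k x * indicator {0..} k)
      * ennreal (2 powr (- k))"
  have "zsum (\<lambda>k. ?c k * ennreal (2 powr k)) \<le> (\<integral>\<^sup>+ t. indicator {0<..} t * ?G t \<partial>lborel)"
  proof (rule nn_integral_dyadic_ge[where c = ?c and G = ?G])
    fix k :: int and t :: real assume kt: "2 powr k < t" "t \<le> 2 powr (k + 1)"
    have "1 \<le> t" if "0 \<le> k"
      using kt that by (smt (verit) ge_one_powr_ge_zero of_int_0_le_iff)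
    then show "?c k \<le> ?G t"
      using wkern_ge[OF M d e kt, of x] by (auto simp: indicator_def)
  qed measurable
  also have "(\<integral>\<^sup>+ t. indicator {0<..} t * ?G t \<partial>lborel) = (\<integral>\<^sup>+ t. ?G t \<partial>lborel)"
    by (intro nn_integral_cong) (auto simp: indicator_def)
  finally show ?thesis unfolding powr_inverse_cancel zsum_cmult .
qed

section \<open>Measurability of ball masses and potentials\<close>

lemma borel_measurable_ball_integral:
  fixes M :: "'a::euclidean_space measure"
  assumes "sigma_finite_measure M" and M [measurable_cong]: "sets M = sets borel"
    and [measurable]: "g \<in> borel_measurable borel"
  shows "(\<lambda>(x, t). \<integral>\<^sup>+ y. g y * indicator (ball x t) y \<partial>M) \<in> borel_measurable (borel \<Otimes>\<^sub>M borel)"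
proof -
  interpret sigma_finite_measure M by fact
  \<comment> \<open>Membership in the ball is written as an inequality between jointly measurable
    functions of x, t and y; integrating out y over a sigma-finite measure then keeps
    measurability.\<close>
  have "(\<lambda>(x, t). \<integral>\<^sup>+ y. (if dist x y < t then g y else 0) \<partial>M)
      \<in> borel_measurable (borel \<Otimes>\<^sub>M borel)"
    by measurable
  moreover have "(\<lambda>y. (if dist x y < t then g y else 0)) = (\<lambda>y. g y * indicator (ball x t) y)" for x t
    by (auto simp: indicator_def)
  ultimately show ?thesis by simp
qed

lemma borel_measurable_wolff_density:
  fixes M :: "'a::euclidean_space measure"
  assumes "sigma_finite_measure M" and M [measurable_cong]: "sets M = sets borel"
    and [measurable]: "g \<in> borel_measurable borel"
  shows "wolff \<alpha> p (density M g) \<in> borel_measurable borel"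
proof -
  have e: "emeasure (density M g) (ball x t) = (\<integral>\<^sup>+ y. g y * indicator (ball x t) y \<partial>M)" for x t
    by (subst emeasure_density) auto
  note [measurable] = borel_measurable_ball_integral[OF assms]
  interpret lborel: sigma_finite_measure lborel by (rule sigma_finite_lborel)
  show ?thesis unfolding wolff_def e by measurable
qed

lemma borel_measurable_emeasure_ball:
  fixes M :: "'a::euclidean_space measure"
  assumes "sigma_finite_measure M" and M [measurable_cong]: "sets M = sets borel"
  shows "(\<lambda>x. emeasure M (ball x t)) \<in> borel_measurable borel"
proof -
  have "(\<lambda>x. (x, t)) \<in> borel \<rightarrow>\<^sub>M borel \<Otimes>\<^sub>M borel" by measurable
  from measurable_compose[OF this borel_measurable_ball_integral[OF assms, of "\<lambda>_. 1"]]
  show ?thesis by simp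
qed

lemma borel_measurable_dterm:
  fixes M :: "'a::euclidean_space measure"
  assumes "sigma_finite_measure M" "sets M = sets borel"
  shows "dterm d e M k \<in> borel_measurable borel"
proof -
  note [measurable] = borel_measurable_emeasure_ball[OF assms]
  show ?thesis unfolding dterm_def by measurable
qed

lemma borel_measurable_zsum:
  assumes "\<And>k. f k \<in> borel_measurable M"
  shows "(\<lambda>x. zsum (\<lambda>k. f k x)) \<in> borel_measurable M"
  unfolding zsum_SUP_sum using assms by measurable

section \<open>The energy bound from the capacity condition\<close>

lemma emeasure_ball_powr:
  fixes y :: "'a::euclidean_space"
  shows "emeasure lborel (ball y (2 powr k))
    = ennreal (unit_ball_vol (real DIM('a)) * 2 powr (k * real DIM('a)))"
  by (subst emeasure_ball) (simp_all add: powr_powr flip: powr_realpow)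

lemma ball_subset_ball_double:
  fixes x y :: "'a::euclidean_space" and k :: real
  assumes "y \<in> ball x (2 powr k)"
  shows "ball x (2 powr k) \<subseteq> ball y (2 powr (k + 1))"
proof
  fix z assume "z \<in> ball x (2 powr k)"
  then have "dist y z < 2 powr k + 2 powr k"
    using assms dist_triangle[of y z x] by (simp add: dist_commute)
  then show "z \<in> ball y (2 powr (k + 1))" by (simp add: powr_add)
qed

text \<open>At scale k the integral of f over B(x,2^k) is at least the assumed lower bound times the
  volume of the ball. After multiplication by the Riesz weight on the shell, the powers of 2 combine
  exactly to those of \<open>dterm\<close>. \<open>K\<close> is the set of scales at which the lower
  bound is available.\<close>

lemma riesz_pot_ge:
  fixes M :: "'a::euclidean_space measure" and f :: "'a \<Rightarrow> real"
    and K :: "int set"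
  assumes M: "sets M = sets borel"
    and par: "1 < p" "0 < \<alpha>" "\<alpha> < real DIM('a)"
    and d: "d = real DIM('a) - \<alpha> * p" and e: "e = 1 / (p - 1)"
    and f [measurable]: "f \<in> borel_measurable borel"
    and ge: "\<And>k y. k \<in> K \<Longrightarrow> y \<in> ball x (2 powr k) \<Longrightarrow>
      c * (emeasure M (ball x (2 powr k)) * ennreal (2 powr (- (k * (real DIM('a) - \<alpha>))))) powe e
        \<le> ennreal (f y)"
  shows "ennreal (unit_ball_vol (real DIM('a)) * 2 powr (- (1 + real DIM('a) - \<alpha>))) * c *
      zsum (\<lambda>k. dterm d e M k x * indicator K k) \<le> riesz_pot \<alpha> f x"
proof -
  let ?n = "real DIM('a)"
  let ?V = "unit_ball_vol ?n"
  let ?G = "\<lambda>r. (\<integral>\<^sup>+ y\<in>ball x r. ennreal (f y) \<partial>lborel) / ennreal (r powr (?n - \<alpha>)) / ennreal r"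
  let ?c = "\<lambda>k::int. ennreal (?V * 2 powr (- (1 + ?n - \<alpha>))) * c * (dterm d e M k x * indicator K k)
      * ennreal (2 powr (- k))"
  have "mono (\<lambda>r. \<integral>\<^sup>+ y\<in>ball x r. ennreal (f y) \<partial>lborel)"
    by (intro monoI nn_integral_mono) (auto simp: indicator_def)
  from borel_measurable_mono_ennreal[OF this]
  have Gm: "?G \<in> borel_measurable borel"
    by measurable
  have "?c k \<le> ?G t" if t: "2 powr k < t" "t \<le> 2 powr (k + 1)" for k :: int and t :: real
  proof (cases "k \<in> K")
    case True
    have t0: "0 < t" using t powr_gt_zero[of 2 "real_of_int k"] by linarith
    let ?m = "emeasure M (ball x (2 powr k))"
    let ?a = "c * (?m * ennreal (2 powr (- (k * (?n - \<alpha>))))) powe e"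
    have "?a * emeasure lborel (ball x (2 powr k)) = (\<integral>\<^sup>+ y. ?a * indicator (ball x (2 powr k)) y \<partial>lborel)"
      by (subst nn_integral_cmult_indicator) auto
    also have "\<dots> \<le> (\<integral>\<^sup>+ y\<in>ball x t. ennreal (f y) \<partial>lborel)"
      using t ge[OF True] by (intro nn_integral_mono) (auto simp: indicator_def)
    finally have I: "?a * ennreal (?V * 2 powr (k * ?n)) \<le> (\<integral>\<^sup>+ y\<in>ball x t. ennreal (f y) \<partial>lborel)"
      by (simp add: emeasure_ball_powr)
    have P: "2 powr ((k + 1) * (\<alpha> - ?n)) \<le> t powr (- (?n - \<alpha>))"
    proof -
      have "(2 powr (k + 1)) powr (- (?n - \<alpha>)) \<le> t powr (- (?n - \<alpha>))"
        using t t0 par by (intro powr_mono2') auto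
      then show ?thesis by (simp add: powr_powr)
    qed
    have Q: "2 powr ((k + 1) * (- 1)) \<le> t powr (- 1)"
    proof -
      have "(2 powr (k + 1)) powr (- 1) \<le> t powr (- 1)"
        using t t0 by (intro powr_mono2') auto
      then show ?thesis unfolding powr_powr by simp
    qed
    have "?c k = c * ?m powe e * (ennreal ?V * (ennreal (2 powr (- (d * k * e)))
        * ennreal (2 powr (- (1 + ?n - \<alpha>))) * ennreal (2 powr (- k))))"
      using True by (simp add: dterm_eq ennreal_mult mult_ac)
    also have "ennreal (2 powr (- (d * k * e))) * ennreal (2 powr (- (1 + ?n - \<alpha>))) * ennreal (2 powr (- k))
       = ennreal (2 powr (- (k * (?n - \<alpha>)) * e)) * ennreal (2 powr (k * ?n)) *
         ennreal (2 powr ((k + 1) * (\<alpha> - ?n))) * ennreal (2 powr ((k + 1) * (- 1)))"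
    proof -
      \<comment> \<open>The identity p e = 1 + e makes the exponents match: k n - k (n - \<alpha>)
        (1 + e) = - k d e.\<close>
      have ae: "\<alpha> * p * e = \<alpha> + \<alpha> * e"
        using par(1) unfolding e by (simp add: field_simps)
      have "- (d * k * e) = k * (\<alpha> * p * e) - k * ?n * e"
        unfolding d by (simp add: algebra_simps)
      then have "- (d * k * e) + - (1 + ?n - \<alpha>) + - k
        = - (k * (?n - \<alpha>)) * e + k * ?n + (k + 1) * (\<alpha> - ?n) + (k + 1) * (- 1)"
        unfolding ae by (simp add: algebra_simps)
      then show ?thesis
        by (simp only: powr_ge_zero of_int_minus of_int_add of_int_1 flip: ennreal_mult powr_add)
    qed
    also have "c * ?m powe e * (ennreal ?V * (ennreal (2 powr (- (k * (?n - \<alpha>)) * e)) * ennreal (2 powr (k * ?n)) *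
         ennreal (2 powr ((k + 1) * (\<alpha> - ?n))) * ennreal (2 powr ((k + 1) * (- 1)))))
      = ?a * ennreal (?V * 2 powr (k * ?n)) *
         ennreal (2 powr ((k + 1) * (\<alpha> - ?n))) * ennreal (2 powr ((k + 1) * (- 1)))"
      by (simp add: powe_mult powe_ennreal powr_powr ennreal_mult mult_ac)
    also have "\<dots> \<le> (\<integral>\<^sup>+ y\<in>ball x t. ennreal (f y) \<partial>lborel) * ennreal (t powr (- (?n - \<alpha>))) * ennreal (t powr (- 1))"
      by (intro mult_mono I ennreal_leI P Q) auto
    also have "\<dots> = ?G t"
      by (simp only: divide_powr_ennreal[OF t0] divide_ennreal_pos[OF t0])
    finally show ?thesis .
  qed simp
  then have "zsum (\<lambda>k. ?c k * ennreal (2 powr k)) \<le> (\<integral>\<^sup>+ t. indicator {0<..} t * ?G t \<partial>lborel)"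
    by (intro nn_integral_dyadic_ge[where c = ?c and G = ?G] Gm) auto
  also have "\<dots> = riesz_pot \<alpha> f x"
    unfolding riesz_pot_def by (intro nn_integral_cong) (simp add: indicator_def)
  finally show ?thesis unfolding powr_inverse_cancel zsum_cmult .
qed

lemma borel_measurable_pair_ball [measurable (raw)]:
  fixes f g :: "'c \<Rightarrow> 'a::euclidean_space"
  assumes [measurable]: "f \<in> borel_measurable N" "g \<in> borel_measurable N"
  shows "(\<lambda>z. indicator (ball (f z) r) (g z) :: ennreal) \<in> borel_measurable N"
proof -
  have "(\<lambda>z. if dist (f z) (g z) < r then 1 else 0 :: ennreal) \<in> borel_measurable N"
    by measurable
  then show ?thesis by (simp add: indicator_def)
qed

text \<open>One factor \<mu>(B(y,r)) is written as an integral over x in B(y,r). For such x the ball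
  B(y,r) lies in B(x,2r), so the remaining factor can be moved to x, and after Fubini the integral
  over y is just the volume of B(x,r).\<close>

lemma nn_integral_emeasure_ball_powe:
  fixes M :: "'a::euclidean_space measure" and k :: real
  assumes sf: "sigma_finite_measure M" and M [measurable_cong]: "sets M = sets borel" and e: "0 \<le> e"
  shows "(\<integral>\<^sup>+ y. emeasure M (ball y (2 powr k)) powe (1 + e) \<partial>lborel)
    \<le> ennreal (unit_ball_vol (real DIM('a)) * 2 powr (k * real DIM('a))) *
       (\<integral>\<^sup>+ x. emeasure M (ball x (2 powr (k + 1))) powe e \<partial>M)"
proof -
  interpret M: sigma_finite_measure M by fact
  interpret pair_sigma_finite M "lborel :: 'a measure"
    by (intro pair_sigma_finite.intro sf sigma_finite_lborel)
  let ?r = "2 powr k"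
  let ?R = "2 powr (k + 1)"
  note [measurable] = borel_measurable_emeasure_ball[OF sf M]
  have "(\<integral>\<^sup>+ y. emeasure M (ball y ?r) powe (1 + e) \<partial>lborel)
     = (\<integral>\<^sup>+ y. \<integral>\<^sup>+ x. emeasure M (ball y ?r) powe e * indicator (ball y ?r) x \<partial>M \<partial>lborel)"
  proof (intro nn_integral_cong)
    fix y
    have "(\<integral>\<^sup>+ x. emeasure M (ball y ?r) powe e * indicator (ball y ?r) x \<partial>M)
      = emeasure M (ball y ?r) powe e * emeasure M (ball y ?r)"
      by (subst nn_integral_cmult_indicator) (auto simp: M)
    then show "emeasure M (ball y ?r) powe (1 + e)
      = (\<integral>\<^sup>+ x. emeasure M (ball y ?r) powe e * indicator (ball y ?r) x \<partial>M)"
      by (simp add: powe_plus mult.commute)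
  qed
  also have "\<dots> \<le> (\<integral>\<^sup>+ y. \<integral>\<^sup>+ x. emeasure M (ball x ?R) powe e * indicator (ball x ?r) y \<partial>M \<partial>lborel)"
  proof (intro nn_integral_mono)
    fix x y
    have "emeasure M (ball y ?r) \<le> emeasure M (ball x ?R)" if "x \<in> ball y ?r"
      using ball_subset_ball_double[OF that] by (intro emeasure_mono) (auto simp: M)
    then show "emeasure M (ball y ?r) powe e * indicator (ball y ?r) x
      \<le> emeasure M (ball x ?R) powe e * indicator (ball x ?r) y"
      using e by (auto simp: indicator_def dist_commute intro!: powe_mono)
  qed
  also have "\<dots> = (\<integral>\<^sup>+ x. \<integral>\<^sup>+ y. emeasure M (ball x ?R) powe e * indicator (ball x ?r) y \<partial>lborel \<partial>M)"
    by (rule Fubini') measurable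
  also have "\<dots> = (\<integral>\<^sup>+ x. ennreal (unit_ball_vol (real DIM('a)) * 2 powr (k * real DIM('a))) *
       emeasure M (ball x ?R) powe e \<partial>M)"
    by (intro nn_integral_cong, subst nn_integral_cmult_indicator)
       (auto simp: emeasure_ball_powr mult.commute)
  also have "\<dots> = ennreal (unit_ball_vol (real DIM('a)) * 2 powr (k * real DIM('a))) *
       (\<integral>\<^sup>+ x. emeasure M (ball x ?R) powe e \<partial>M)"
    by (rule nn_integral_cmult) measurable
  finally show ?thesis .
qed

text \<open>The \<open>p\<close>-th power of the test function for the capacity of a level set of the potential.\<close>

definition trialp :: "real \<Rightarrow> real \<Rightarrow> 'a::euclidean_space measure \<Rightarrow> int \<Rightarrow> 'a \<Rightarrow> ennreal" where
  "trialp b e M N y = zsum (\<lambda>k. (emeasure M (ball y (2 powr (k + 1))) * ennreal (2 powr (- (real_of_int k * b))))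
     powe (1 + e) * indicator {N..} k)"

lemma borel_measurable_trialp:
  assumes "sigma_finite_measure M" "sets M = sets borel"
  shows "trialp b e M N \<in> borel_measurable borel"
proof -
  note [measurable] = borel_measurable_emeasure_ball[OF assms]
  show ?thesis unfolding trialp_def by (intro borel_measurable_zsum) measurable
qed

lemma trialp_finite:
  assumes "finite_measure M" "0 < b" "0 < e"
  shows "trialp b e M N y < top"
proof -
  have "trialp b e M N y \<le> zsum (\<lambda>k. emeasure M (space M) powe (1 + e) *
      (ennreal (2 powr (- (b * (1 + e) * k))) * indicator {N..} k))"
    unfolding trialp_def
  proof (intro zsum_mono)
    fix k :: int
    have "(emeasure M (ball y (2 powr (k + 1))) * ennreal (2 powr (- (real_of_int k * b)))) powe (1 + e)
      = emeasure M (ball y (2 powr (k + 1))) powe (1 + e) * ennreal (2 powr (- (b * (1 + e) * k)))"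
      by (simp add: powe_mult powe_ennreal powr_powr mult_ac)
    also have "\<dots> \<le> emeasure M (space M) powe (1 + e) * ennreal (2 powr (- (b * (1 + e) * k)))"
      using assms by (intro mult_right_mono powe_mono emeasure_space) auto
    finally show "(emeasure M (ball y (2 powr (k + 1))) * ennreal (2 powr (- (real_of_int k * b)))) powe (1 + e) *
        indicator {N..} k
      \<le> emeasure M (space M) powe (1 + e) * (ennreal (2 powr (- (b * (1 + e) * k))) * indicator {N..} k)"
      by (auto simp: indicator_def)
  qed
  also have "\<dots> = emeasure M (space M) powe (1 + e) *
      zsum (\<lambda>k. ennreal (2 powr (- (b * (1 + e) * k))) * indicator {N..} k)"
    by (rule zsum_cmult)
  also have "\<dots> < top"
  proof -
    have "emeasure M (space M) < top"
      using assms(1) by (simp add: finite_measure.emeasure_finite less_top[symmetric])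
    moreover have "0 < b * (1 + e)" using assms by simp
    ultimately show ?thesis
      using zsum_geometric_finite powe_less_top by (auto simp: ennreal_mult_less_top)
  qed
  finally show ?thesis .
qed

lemma dterm_upper_finite:
  fixes d e :: real and N :: int
  assumes "finite_measure M" "0 < d" "0 < e"
  shows "zsum (\<lambda>k. dterm d e M k x * indicator {N..} k)
    \<le> emeasure M (space M) powe e * zsum (\<lambda>k. ennreal (2 powr (- (d * e * k))) * indicator {N..} k)"
  unfolding zsum_cmult[symmetric]
proof (intro zsum_mono)
  fix k :: int
  have "dterm d e M k x \<le> emeasure M (space M) powe e * ennreal (2 powr (- (d * e * k)))"
    unfolding dterm_eq using assms
    by (intro mult_mono powe_mono emeasure_space) (auto simp: mult_ac)
  then show "dterm d e M k x * indicator {N..} k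
    \<le> emeasure M (space M) powe e * (ennreal (2 powr (- (d * e * k))) * indicator {N..} k)"
    by (auto simp: indicator_def)
qed

lemma dterm_upper_bound_finite:
  fixes d e :: real and N :: int
  assumes "finite_measure M" "0 < d" "0 < e"
  shows "emeasure M (space M) powe e * zsum (\<lambda>k. ennreal (2 powr (- (d * e * k))) * indicator {N..} k) < top"
proof -
  have "emeasure M (space M) powe e < top"
    using assms(1) by (intro powe_less_top) (simp add: finite_measure.emeasure_finite less_top[symmetric])
  then show ?thesis
    using zsum_geometric_finite[of "d * e" N] assms by (simp add: ennreal_mult_less_top)
qed

text \<open>Scale by scale this is \<open>nn_integral_emeasure_ball_powe\<close> at radius 2^(k+1);
  the doubling there moves the term to scale k + 2, which accounts for the factor 2^(2de).\<close>

lemma nn_integral_trialp: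
  fixes M :: "'a::euclidean_space measure"
  assumes sf: "sigma_finite_measure M" and M [measurable_cong]: "sets M = sets borel"
    and par: "1 < p"
    and d: "d = real DIM('a) - \<alpha> * p" "0 < d" and e: "e = 1 / (p - 1)"
  shows "(\<integral>\<^sup>+ y. trialp (real DIM('a) - \<alpha>) e M N y \<partial>lborel)
    \<le> ennreal (unit_ball_vol (real DIM('a)) * 2 powr (real DIM('a) + 2 * d * e)) *
       (\<integral>\<^sup>+ x. zsum (\<lambda>k. dterm d e M k x * indicator {N..} k) \<partial>M)"
proof -
  let ?n = "real DIM('a)"
  let ?V = "unit_ball_vol ?n"
  have e0: "0 < e" using par e by simp
  note [measurable] = borel_measurable_emeasure_ball[OF sf M] borel_measurable_dterm[OF sf M]
  have each: "(\<integral>\<^sup>+ y. (emeasure M (ball y (2 powr (k + 1))) * ennreal (2 powr (- (k * (?n - \<alpha>)))))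
       powe (1 + e) \<partial>lborel)
     \<le> ennreal (?V * 2 powr (?n + 2 * d * e)) * (\<integral>\<^sup>+ x. dterm d e M (k + 2) x \<partial>M)" for k :: int
  proof -
    have "(\<integral>\<^sup>+ y. (emeasure M (ball y (2 powr (k + 1))) * ennreal (2 powr (- (k * (?n - \<alpha>)))))
       powe (1 + e) \<partial>lborel)
      = (\<integral>\<^sup>+ y. ennreal (2 powr (- (k * (?n - \<alpha>)) * (1 + e))) *
          emeasure M (ball y (2 powr (k + 1))) powe (1 + e) \<partial>lborel)"
      by (intro nn_integral_cong) (simp add: powe_mult powe_ennreal powr_powr mult_ac)
    also have "\<dots> = ennreal (2 powr (- (k * (?n - \<alpha>)) * (1 + e))) *
        (\<integral>\<^sup>+ y. emeasure M (ball y (2 powr (k + 1))) powe (1 + e) \<partial>lborel)"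
      by (rule nn_integral_cmult) measurable
    also have "\<dots> \<le> ennreal (2 powr (- (k * (?n - \<alpha>)) * (1 + e))) *
        (ennreal (?V * 2 powr ((k + 1) * ?n)) *
       (\<integral>\<^sup>+ x. emeasure M (ball x (2 powr (k + 1 + 1))) powe e \<partial>M))"
      using nn_integral_emeasure_ball_powe[OF sf M, of e "k + 1"] e0
      by (intro mult_left_mono) auto
    also have "\<dots> = ennreal ?V * (ennreal (2 powr (- (k * (?n - \<alpha>)) * (1 + e))) * ennreal (2 powr ((k + 1) * ?n))) *
       (\<integral>\<^sup>+ x. emeasure M (ball x (2 powr (k + 2))) powe e \<partial>M)"
      by (simp add: ennreal_mult mult_ac add.commute)
    also have "ennreal (2 powr (- (k * (?n - \<alpha>)) * (1 + e))) * ennreal (2 powr ((k + 1) * ?n))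
       = ennreal (2 powr (?n + 2 * d * e)) * ennreal (2 powr (- (d * (k + 2) * e)))"
    proof -
      have ae: "\<alpha> * p * e = \<alpha> + \<alpha> * e"
        using par unfolding e by (simp add: field_simps)
      have "- (d * (k + 2) * e) = k * (\<alpha> * p * e) - k * ?n * e - 2 * d * e"
        unfolding d by (simp add: algebra_simps)
      then have "- (k * (?n - \<alpha>)) * (1 + e) + (k + 1) * ?n = ?n + 2 * d * e + - (d * (k + 2) * e)"
        unfolding ae by (simp add: algebra_simps)
      then show ?thesis
        by (simp only: powr_ge_zero flip: ennreal_mult powr_add)
    qed
    also have "ennreal ?V * (ennreal (2 powr (?n + 2 * d * e)) * ennreal (2 powr (- (d * (k + 2) * e)))) *
       (\<integral>\<^sup>+ x. emeasure M (ball x (2 powr (k + 2))) powe e \<partial>M)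
      = ennreal (?V * 2 powr (?n + 2 * d * e)) * (ennreal (2 powr (- (d * (k + 2) * e))) *
       (\<integral>\<^sup>+ x. emeasure M (ball x (2 powr (k + 2))) powe e \<partial>M))"
      by (simp add: ennreal_mult mult_ac)
    also have "ennreal (2 powr (- (d * (k + 2) * e))) *
       (\<integral>\<^sup>+ x. emeasure M (ball x (2 powr (k + 2))) powe e \<partial>M) = (\<integral>\<^sup>+ x. dterm d e M (k + 2) x \<partial>M)"
      by (subst nn_integral_cmult[symmetric], measurable, intro nn_integral_cong)
         (simp add: dterm_eq mult_ac)
    finally show ?thesis .
  qed
  have "(\<integral>\<^sup>+ y. trialp (?n - \<alpha>) e M N y \<partial>lborel)
    = zsum (\<lambda>k. (\<integral>\<^sup>+ y. (emeasure M (ball y (2 powr (k + 1))) * ennreal (2 powr (- (k * (?n - \<alpha>)))))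
       powe (1 + e) * indicator {N..} k \<partial>lborel))"
    unfolding trialp_def by (rule zsum_swap) measurable
  \<comment> \<open>If k \<ge> N then k + 2 \<ge> N, so the cutoff survives the shift of
    scale.\<close>
  also have "\<dots> \<le> zsum (\<lambda>k. ennreal (?V * 2 powr (?n + 2 * d * e)) *
      ((\<integral>\<^sup>+ x. dterm d e M (k + 2) x * indicator {N..} (k + 2) \<partial>M)))"
    using each by (intro zsum_mono) (auto simp: indicator_def)
  also have "\<dots> = ennreal (?V * 2 powr (?n + 2 * d * e)) *
      zsum (\<lambda>k. \<integral>\<^sup>+ x. dterm d e M k x * indicator {N..} k \<partial>M)"
    unfolding zsum_cmult by (subst zsum_shift) rule
  also have "zsum (\<lambda>k. \<integral>\<^sup>+ x. dterm d e M k x * indicator {N..} k \<partial>M)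
     = (\<integral>\<^sup>+ x. zsum (\<lambda>k. dterm d e M k x * indicator {N..} k) \<partial>M)"
    by (rule zsum_swap[symmetric]) measurable
  finally show ?thesis .
qed

text \<open>On a compact part K of the level set the normalised trial function has Riesz potential
  at least 1. It is therefore a competitor for the capacity of K, and its energy is bounded by
  (\<kappa> t)^(-p) B times the integral of S. Inner regularity then passes from compact sets to the
  level set.\<close>

lemma weak_type_dpot:
  fixes M :: "'a::euclidean_space measure" and N :: int
  assumes fin: "finite_measure M" and M [measurable_cong]: "sets M = sets borel"
    and par: "1 < p" "0 < \<alpha>" "\<alpha> < real DIM('a)"
    and d: "d = real DIM('a) - \<alpha> * p" "0 < d" and e: "e = 1 / (p - 1)"
    and cap: "\<And>E. compact E \<Longrightarrow> emeasure M E \<le> ennreal C * cap \<alpha> p E" and C: "0 < C"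
    and t: "0 < t"
    and \<kappa>: "\<kappa> = unit_ball_vol (real DIM('a)) * 2 powr (- (1 + real DIM('a) - \<alpha>))"
    and B: "B = unit_ball_vol (real DIM('a)) * 2 powr (real DIM('a) + 2 * d * e)"
  defines "S \<equiv> \<lambda>x. zsum (\<lambda>k. dterm d e M k x * indicator {N..} k)"
  shows "emeasure M {x. ennreal t < S x}
    \<le> ennreal (C * (\<kappa> * t) powr (- p) * B) * (\<integral>\<^sup>+ x. S x \<partial>M)"
proof -
  interpret finite_measure M by fact
  have sf: "sigma_finite_measure M" by unfold_locales
  let ?n = "real DIM('a)"
  have e0: "0 < e" using par e by simp
  have k0: "0 < \<kappa>" "0 < B" using \<kappa> B by simp_all
  note [measurable] = borel_measurable_dterm[OF sf M] borel_measurable_trialp[OF sf M]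
  have [measurable]: "S \<in> borel_measurable borel"
    unfolding S_def by (intro borel_measurable_zsum) measurable
  define F where "F = trialp (?n - \<alpha>) e M N"
  \<comment> \<open>The p-th root of the trial energy density, scaled so that I_\<alpha> f \<ge>
    \<kappa> S / (\<kappa> t), which exceeds 1 where S > t. Since F is finite everywhere, the
    conversion to a real number loses nothing.\<close>
  define f where "f y = enn2real (F y powe (1 / p)) / (\<kappa> * t)" for y
  have [measurable]: "F \<in> borel_measurable borel" unfolding F_def by measurable
  have fm [measurable]: "f \<in> borel_measurable borel" unfolding f_def by measurable
  have Ftop: "F y < top" for y
    unfolding F_def using trialp_finite[OF fin _ e0] par by simp
  have ef: "ennreal (f y) = ennreal (1 / (\<kappa> * t)) * F y powe (1 / p)" for y
  proof -
    have "ennreal (f y) = ennreal (1 / (\<kappa> * t)) * ennreal (enn2real (F y powe (1 / p)))"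
      unfolding f_def using k0 t by (subst ennreal_mult[symmetric]) auto
    then show ?thesis using powe_less_top[OF Ftop, of y "1 / p"] by simp
  qed
  have fp: "ennreal (f y powr p) = ennreal ((\<kappa> * t) powr (- p)) * F y" for y
  proof -
    have f0: "0 \<le> f y" unfolding f_def using k0 t by simp
    have "ennreal (f y powr p) = ennreal (1 / (\<kappa> * t)) powe p * F y"
      unfolding powe_ennreal[OF f0, symmetric] ef powe_mult powe_powe using par by simp
    moreover have "(1 / (\<kappa> * t)) powr p = (\<kappa> * t) powr (- p)"
      using k0 t by (simp add: powr_divide powr_minus_divide powr_mult)
    ultimately show ?thesis using k0 t by (simp add: powe_ennreal)
  qed
  have Ip: "(\<integral>\<^sup>+ y. ennreal (f y powr p) \<partial>lborel)
     \<le> ennreal ((\<kappa> * t) powr (- p) * B) * (\<integral>\<^sup>+ x. S x \<partial>M)"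
  proof -
    have "(\<integral>\<^sup>+ y. ennreal (f y powr p) \<partial>lborel) = ennreal ((\<kappa> * t) powr (- p)) * (\<integral>\<^sup>+ y. F y \<partial>lborel)"
      unfolding fp by (rule nn_integral_cmult) measurable
    also have "\<dots> \<le> ennreal ((\<kappa> * t) powr (- p)) * (ennreal B * (\<integral>\<^sup>+ x. S x \<partial>M))"
      unfolding F_def S_def B by (intro mult_left_mono nn_integral_trialp[OF sf M par(1) d e]) auto
    finally show ?thesis using k0 by (simp add: ennreal_mult mult.assoc)
  qed
  \<comment> \<open>The cut-off potential of a finite measure is uniformly bounded; this makes the
    energy of f finite, as admissibility requires.\<close>
  have Xfin: "(\<integral>\<^sup>+ x. S x \<partial>M) < top"
  proof -
    let ?c = "emeasure M (space M) powe e * zsum (\<lambda>k. ennreal (2 powr (- (d * e * k))) * indicator {N..} k)"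
    have "(\<integral>\<^sup>+ x. S x \<partial>M) \<le> (\<integral>\<^sup>+ x. ?c \<partial>M)"
      unfolding S_def by (intro nn_integral_mono dterm_upper_finite[OF fin d(2) e0])
    also have "\<dots> = ?c * emeasure M (space M)" by simp
    also have "\<dots> < top"
      using dterm_upper_bound_finite[OF fin d(2) e0, of N]
      by (subst ennreal_mult_less_top) (simp add: less_top[symmetric])
    finally show ?thesis .
  qed
  have each: "emeasure M K \<le> ennreal (C * (\<kappa> * t) powr (- p) * B) * (\<integral>\<^sup>+ x. S x \<partial>M)"
    if K: "compact K" "K \<subseteq> {x. ennreal t < S x}" for K
  proof -
    have riesz: "1 \<le> riesz_pot \<alpha> f x" if "x \<in> K" for x
    proof -
      have "ennreal t \<le> S x" using that K(2) by auto
      then have "ennreal \<kappa> * ennreal (1 / (\<kappa> * t)) * ennreal t \<le> ennreal \<kappa> * ennreal (1 / (\<kappa> * t)) * S x"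
        by (intro mult_left_mono) auto
      also have "ennreal \<kappa> * ennreal (1 / (\<kappa> * t)) * ennreal t = 1"
        using k0 t by (simp flip: ennreal_mult)
      also have "ennreal \<kappa> * ennreal (1 / (\<kappa> * t)) * S x \<le> riesz_pot \<alpha> f x"
        unfolding \<kappa> S_def
      proof (rule riesz_pot_ge[OF M par d(1) e fm])
        \<comment> \<open>A single scale of the sum suffices: for y in B(x,2^k), the ball of radius
          2^(k+1) about y contains B(x,2^k).\<close>
        fix k :: int and y assume k: "k \<in> {N..}" and y: "y \<in> ball x (2 powr k)"
        have "(emeasure M (ball x (2 powr k)) * ennreal (2 powr (- (k * (?n - \<alpha>))))) powe e
          = ((emeasure M (ball x (2 powr k)) * ennreal (2 powr (- (k * (?n - \<alpha>))))) powe (1 + e)) powe (1 / p)"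
        proof -
          have "(1 + e) * (1 / p) = e" using par e by (simp add: field_simps)
          then show ?thesis unfolding powe_powe by simp
        qed
        also have "\<dots> \<le> ((emeasure M (ball y (2 powr (k + 1))) * ennreal (2 powr (- (k * (?n - \<alpha>))))) powe (1 + e)) powe (1 / p)"
          using e0 par ball_subset_ball_double[OF y]
          by (intro powe_mono mult_right_mono emeasure_mono) (auto simp: M)
        also have "\<dots> \<le> F y powe (1 / p)"
          unfolding F_def trialp_def using k par
            zsum_ge[of "\<lambda>k. (emeasure M (ball y (2 powr (k + 1))) * ennreal (2 powr (- (k * (?n - \<alpha>)))))
                 powe (1 + e) * indicator {N..} k" k]
          by (intro powe_mono) auto
        finally show "ennreal (1 / (unit_ball_vol ?n * 2 powr (- (1 + ?n - \<alpha>)) * t)) *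
           (emeasure M (ball x (2 powr k)) * ennreal (2 powr (- (k * (?n - \<alpha>))))) powe e \<le> ennreal (f y)"
          unfolding ef \<kappa> by (intro mult_left_mono) auto
      qed
      finally show ?thesis .
    qed
    have "cap \<alpha> p K \<le> (\<integral>\<^sup>+ y. ennreal (f y powr p) \<partial>lborel)"
      unfolding cap_def
    proof (rule INF_lower, safe)
      show "f \<in> borel_measurable lborel" by measurable
      show "0 \<le> f y" for y unfolding f_def using k0 t by simp
      show "(\<integral>\<^sup>+ y. ennreal (f y powr p) \<partial>lborel) < \<infinity>"
        using Ip Xfin by (auto simp: ennreal_mult_less_top intro: le_less_trans)
    qed (rule riesz)
    then have "ennreal C * cap \<alpha> p K \<le> ennreal C * (ennreal ((\<kappa> * t) powr (- p) * B) * (\<integral>\<^sup>+ x. S x \<partial>M))"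
      by (intro mult_left_mono order_trans[OF _ Ip]) auto
    then show ?thesis
      using cap[OF K(1)] C k0 by (simp add: ennreal_mult mult.assoc)
  qed
  have "{x. ennreal t < S x} \<in> sets borel" by measurable
  then have "emeasure M {x. ennreal t < S x} = (SUP K \<in> {K. K \<subseteq> {x. ennreal t < S x} \<and> compact K}. emeasure M K)"
    by (intro inner_regular) (auto simp: M)
  also have "\<dots> \<le> ennreal (C * (\<kappa> * t) powr (- p) * B) * (\<integral>\<^sup>+ x. S x \<partial>M)"
    by (intro SUP_least each) auto
  finally show ?thesis .
qed

text \<open>Summing over dyadic levels, a weak-type bound of order \<open>p > 1\<close> in terms of the integral
  itself improves to a bound by the total mass, because \<open>T\<^bsup>1-p\<^esup>\<close> is small for large \<open>T\<close>.\<close>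

lemma weak_type_absorb:
  fixes S :: "'b \<Rightarrow> ennreal"
  assumes S [measurable]: "S \<in> borel_measurable M"
    and fin: "(\<integral>\<^sup>+ x. S x \<partial>M) < top" "\<And>x. x \<in> space M \<Longrightarrow> S x < top"
    and p: "1 < p" and Q: "0 < Q"
    and weak: "\<And>t. 0 < t \<Longrightarrow> emeasure M {x \<in> space M. ennreal t < S x}
        \<le> ennreal (Q * t powr (- p)) * (\<integral>\<^sup>+ x. S x \<partial>M)"
  shows "(\<integral>\<^sup>+ x. S x \<partial>M)
    \<le> ennreal (2 * (4 * Q / (1 - 2 powr (1 - p))) powr (1 / (p - 1))) * emeasure M (space M)"
proof -
  define \<theta> :: real where "\<theta> = 2 powr (1 - p)"
  \<comment> \<open>T is chosen so that the geometric series over the levels above T adds up to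
    exactly one half of the integral; see \<open>TQ\<close>.\<close>
  define T where "T = (4 * Q / (1 - \<theta>)) powr (1 / (p - 1))"
  let ?X = "\<integral>\<^sup>+ x. S x \<partial>M"
  have th: "0 < \<theta>" "\<theta> < 1" using p by (auto simp: \<theta>_def powr_less_one)
  have T: "0 < T" using Q th by (simp add: T_def)
  have TQ: "2 * Q * T powr (1 - p) / (1 - \<theta>) = 1 / 2"
  proof -
    have "T powr (1 - p) = (4 * Q / (1 - \<theta>)) powr (- 1)"
    proof -
      have "1 / (p - 1) * (1 - p) = - 1" using p by (simp add: field_simps)
      then show ?thesis unfolding T_def powr_powr by simp
    qed
    also have "\<dots> = (1 - \<theta>) / (4 * Q)"
      using Q th by (simp add: powr_minus)
    finally show ?thesis using Q th by simp
  qed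
  let ?E = "\<lambda>j. {x \<in> space M. ennreal (2 ^ j * T) < S x}"
  have "?X \<le> (\<integral>\<^sup>+ x. ennreal T + (\<Sum>j. ennreal (2 * 2 ^ j * T) * indicator (?E j) x) \<partial>M)"
  proof (rule nn_integral_mono)
    fix x assume x: "x \<in> space M"
    show "S x \<le> ennreal T + (\<Sum>j. ennreal (2 * 2 ^ j * T) * indicator (?E j) x)"
    proof (cases "S x \<le> ennreal T")
      case False
      obtain s where s: "S x = ennreal s" "0 \<le> s" using fin(2)[OF x] by (cases "S x") auto
      obtain i where "s / T < 2 ^ i" using real_arch_pow[of 2 "s / T"] by auto
      then have i: "s \<le> 2 ^ i * T" using T by (simp add: field_simps)
      \<comment> \<open>The least i with S(x) \<le> 2^i T has a predecessor j, and 2^j T < S(x)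
        \<le> 2 * 2^j T: the level j alone pays for S(x).\<close>
      define i0 where "i0 = (LEAST i. s \<le> 2 ^ i * T)"
      have i0: "s \<le> 2 ^ i0 * T" unfolding i0_def by (rule LeastI) (rule i)
      have "i0 \<noteq> 0" using False i0 s T by (intro notI) auto
      then obtain j where j: "i0 = Suc j" by (cases i0) auto
      then have "\<not> s \<le> 2 ^ j * T" using not_less_Least[of j "\<lambda>i. s \<le> 2 ^ i * T"] i0_def by auto
      then have "x \<in> ?E j" using x s T by (simp add: ennreal_less_iff)
      then have "S x \<le> ennreal (2 * 2 ^ j * T) * indicator (?E j) x"
        using i0 j s by (simp add: ennreal_leI)
      also have "\<dots> \<le> (\<Sum>j. ennreal (2 * 2 ^ j * T) * indicator (?E j) x)"
        using sum_le_suminf[of "\<lambda>j. ennreal (2 * 2 ^ j * T) * indicator (?E j) x" "{j}"]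
        by (simp del: sum_mult_indicator)
      finally show ?thesis by (simp add: add_increasing)
    qed (simp add: add_increasing2)
  qed
  also have "\<dots> = ennreal T * emeasure M (space M) + (\<Sum>j. ennreal (2 * 2 ^ j * T) * emeasure M (?E j))"
    by (subst nn_integral_add, measurable, subst nn_integral_suminf, measurable)
       (simp add: nn_integral_cmult_indicator)
  also have "(\<Sum>j. ennreal (2 * 2 ^ j * T) * emeasure M (?E j))
     \<le> (\<Sum>j. ennreal (2 * Q * T powr (1 - p) * \<theta> ^ j) * ?X)"
  proof (rule suminf_le)
    fix j
    have "ennreal (2 * 2 ^ j * T) * emeasure M (?E j)
      \<le> ennreal (2 * 2 ^ j * T) * (ennreal (Q * (2 ^ j * T) powr (- p)) * ?X)"
      using T by (intro mult_left_mono weak) auto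
    also have "\<dots> = ennreal (2 * 2 ^ j * T * (Q * (2 ^ j * T) powr (- p))) * ?X"
      using T Q by (simp add: ennreal_mult mult.assoc)
    also have "2 * 2 ^ j * T * (Q * (2 ^ j * T) powr (- p)) = 2 * Q * T powr (1 - p) * \<theta> ^ j"
    proof -
      have "2 ^ j * T * (2 ^ j * T) powr (- p) = (2 ^ j * T) powr (1 - p)"
        using T by (simp add: powr_diff powr_minus divide_inverse)
      also have "\<dots> = T powr (1 - p) * \<theta> ^ j"
        using T by (simp add: powr_mult \<theta>_def powr_powr mult_ac flip: powr_realpow)
      finally show ?thesis by (simp add: mult_ac)
    qed
    finally show "ennreal (2 * 2 ^ j * T) * emeasure M (?E j)
      \<le> ennreal (2 * Q * T powr (1 - p) * \<theta> ^ j) * ?X" .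
  qed auto
  also have "(\<Sum>j. ennreal (2 * Q * T powr (1 - p) * \<theta> ^ j) * ?X) = ennreal (1 / 2) * ?X"
  proof -
    have s: "summable (\<lambda>j. 2 * Q * T powr (1 - p) * \<theta> ^ j)"
      using th by (intro summable_mult summable_geometric) auto
    have "(\<Sum>j. ennreal (2 * Q * T powr (1 - p) * \<theta> ^ j)) = ennreal (\<Sum>j. 2 * Q * T powr (1 - p) * \<theta> ^ j)"
      using th Q s by (intro suminf_ennreal2) auto
    also have "(\<Sum>j. 2 * Q * T powr (1 - p) * \<theta> ^ j) = 1 / 2"
      using th TQ by (subst suminf_mult) (auto simp: suminf_geometric)
    finally show ?thesis by simp
  qed
  finally have le: "?X \<le> ennreal T * emeasure M (space M) + ennreal (1 / 2) * ?X"
    by simp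
  \<comment> \<open>For infinite mass the right side is \<infinity>, as T > 0. Otherwise the
    integral is a real number by assumption, and half of it can be subtracted.\<close>
  show ?thesis
  proof (cases "emeasure M (space M) = top")
    case True
    then show ?thesis using T by (simp add: T_def \<theta>_def ennreal_mult_top ennreal_eq_0_iff)
  next
    case False
    then obtain m where m: "emeasure M (space M) = ennreal m" "0 \<le> m" by (cases "emeasure M (space M)") auto
    obtain X where X: "?X = ennreal X" "0 \<le> X" using fin(1) by (cases ?X) auto
    have "X \<le> T * m + 1 / 2 * X"
    proof -
      have "ennreal (T * m + 1 / 2 * X) = ennreal T * ennreal m + ennreal (1 / 2) * ennreal X"
        using T m X by (subst ennreal_plus) (auto simp only: ennreal_mult intro!: mult_nonneg_nonneg)
      then show ?thesis
        using le m X T unfolding m X by (metis add_nonneg_nonneg ennreal_le_iff less_imp_le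
            mult_nonneg_nonneg zero_le_divide_1_iff zero_le_numeral)
    qed
    then have "X \<le> 2 * T * m" by simp
    then show ?thesis using m X T unfolding m X T_def \<theta>_def by (simp flip: ennreal_mult)
  qed
qed

text \<open>The weak-type bound is absorbed for each cutoff with a constant independent of N, and
  monotone convergence removes the cutoff. The constant A precedes the measure, so it also serves
  all restrictions of a given measure.\<close>

lemma energy_le_mass:
  fixes p \<alpha> C d e :: real
  assumes par: "1 < p" "0 < \<alpha>" "\<alpha> < real DIM('a::euclidean_space)"
    and d: "d = real DIM('a) - \<alpha> * p" "0 < d" and e: "e = 1 / (p - 1)" and C: "0 < C"
  shows "\<exists>A>0. \<forall>M :: 'a measure. finite_measure M \<longrightarrow> sets M = sets borel \<longrightarrow>
     (\<forall>E. compact E \<longrightarrow> emeasure M E \<le> ennreal C * cap \<alpha> p E) \<longrightarrow>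
     (\<integral>\<^sup>+ x. dpot d e M x \<partial>M) \<le> ennreal A * emeasure M (space M)"
proof -
  define \<kappa> where "\<kappa> = unit_ball_vol (real DIM('a)) * 2 powr (- (1 + real DIM('a) - \<alpha>))"
  define B where "B = unit_ball_vol (real DIM('a)) * 2 powr (real DIM('a) + 2 * d * e)"
  define Q where "Q = C * \<kappa> powr (- p) * B"
  define A where "A = 2 * (4 * Q / (1 - 2 powr (1 - p))) powr (1 / (p - 1))"
  have pos: "0 < \<kappa>" "0 < B" by (auto simp: \<kappa>_def B_def)
  then have Q: "0 < Q" using C by (simp add: Q_def)
  have th: "(2::real) powr (1 - p) < 1" using par by (simp add: powr_less_one)
  have A: "0 < A" unfolding A_def using Q th par by simp
  have e0: "0 < e" using par e by simp
  show ?thesis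
  proof (intro exI[of _ A] conjI A allI impI)
    fix M :: "'a measure"
    assume fin: "finite_measure M" and M [measurable_cong]: "sets M = sets borel"
      and cap: "\<forall>E. compact E \<longrightarrow> emeasure M E \<le> ennreal C * cap \<alpha> p E"
    interpret finite_measure M by fact
    have sf: "sigma_finite_measure M" by unfold_locales
    have sp: "space M = UNIV" using sets_eq_imp_space_eq[OF M] by simp
    note [measurable] = borel_measurable_dterm[OF sf M]
    have trunc: "(\<integral>\<^sup>+ x. zsum (\<lambda>k. dterm d e M k x * indicator {N..} k) \<partial>M) \<le> ennreal A * emeasure M (space M)"
      for N
      unfolding A_def
    proof (rule weak_type_absorb)
      let ?S = "\<lambda>x. zsum (\<lambda>k. dterm d e M k x * indicator {N..} k)"
      let ?c = "emeasure M (space M) powe e * zsum (\<lambda>k. ennreal (2 powr (- (d * e * k))) * indicator {N..} k)"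
      have c: "?c < top"
        by (rule dterm_upper_bound_finite[OF fin d(2) e0])
      show "?S \<in> borel_measurable M"
        by (intro borel_measurable_zsum) measurable
      show fS: "?S x < top" for x
        using dterm_upper_finite[OF fin d(2) e0] c by (rule le_less_trans)
      have "(\<integral>\<^sup>+ x. ?S x \<partial>M) \<le> (\<integral>\<^sup>+ x. ?c \<partial>M)"
        by (intro nn_integral_mono dterm_upper_finite[OF fin d(2) e0])
      also have "\<dots> < top"
        using c by (subst nn_integral_const, subst ennreal_mult_less_top) (simp add: less_top[symmetric])
      finally show "(\<integral>\<^sup>+ x. ?S x \<partial>M) < top" .
      show "emeasure M {x \<in> space M. ennreal t < ?S x}
        \<le> ennreal (Q * t powr (- p)) * (\<integral>\<^sup>+ x. ?S x \<partial>M)" if "0 < t" for t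
        using weak_type_dpot[OF fin M par d e _ C that \<kappa>_def B_def, of N] cap pos that sp
        by (simp add: Q_def powr_mult mult_ac)
    qed (use par Q in auto)
    have "(\<integral>\<^sup>+ x. dpot d e M x \<partial>M) = (SUP n. \<integral>\<^sup>+ x. (\<Sum>k\<in>{- int n..int n}. dterm d e M k x) \<partial>M)"
      unfolding zsum_SUP_sum
      by (intro nn_integral_monotone_convergence_SUP)
         (auto simp: incseq_def le_fun_def intro!: sum_mono2)
    also have "\<dots> \<le> ennreal A * emeasure M (space M)"
    proof (rule SUP_least)
      fix n
      have "(\<Sum>k\<in>{- int n..int n}. dterm d e M k x)
        \<le> zsum (\<lambda>k. dterm d e M k x * indicator {- int n..} k)" for x
      proof -
        have "(\<Sum>k\<in>{- int n..int n}. dterm d e M k x)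
          = (\<Sum>k\<in>{- int n..int n}. dterm d e M k x * indicator {- int n..} k)"
          by (intro sum.cong) auto
        then show ?thesis by (simp only: zsum_ge_sum finite_atLeastAtMost_int)
      qed
      then show "(\<integral>\<^sup>+ x. (\<Sum>k\<in>{- int n..int n}. dterm d e M k x) \<partial>M) \<le> ennreal A * emeasure M (space M)"
        by (intro order_trans[OF nn_integral_mono trunc])
    qed
    finally show "(\<integral>\<^sup>+ x. dpot d e M x \<partial>M) \<le> ennreal A * emeasure M (space M)" .
  qed
qed

section \<open>Moments of truncated potentials\<close>

abbreviation dlow :: "real \<Rightarrow> real \<Rightarrow> 'a::euclidean_space measure \<Rightarrow> int \<Rightarrow> 'a \<Rightarrow> ennreal" where
  "dlow d e M k x \<equiv> zsum (\<lambda>j. dterm d e M j x * indicator {..k} j)"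

text \<open>For integers i, j < k one has 2^i + 2^j \<le> 2^k.\<close>

lemma ball_powr_subset:
  fixes x z :: "'a::euclidean_space" and i j k :: int
  assumes "z \<in> ball x (2 powr i)" "i < k" "j < k"
  shows "ball z (2 powr j) \<subseteq> ball x (2 powr k)"
proof
  fix y assume "y \<in> ball z (2 powr j)"
  then have "dist x y < 2 powr i + 2 powr j"
    using assms(1) dist_triangle[of x y z] by simp
  also have "\<dots> \<le> 2 powr (real_of_int k - 1) + 2 powr (real_of_int k - 1)"
    using assms(2,3) by (intro add_mono powr_mono) auto
  also have "\<dots> = 2 powr k" by (simp add: powr_diff)
  finally show "y \<in> ball x (2 powr k)" by simp
qed

text \<open>The restriction of M to the doubled ball is finite and inherits the capacity condition
  with the same C, so the global energy bound applies to it. For y in the inner ball and j \<le> k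
  the balls B(y,2^j) stay inside the doubled ball, so restriction does not change these
  terms.\<close>

lemma local_energy:
  fixes M :: "'a::euclidean_space measure" and k :: int
  assumes M [measurable_cong]: "sets M = sets borel"
    and fin: "\<And>K. compact K \<Longrightarrow> emeasure M K < \<infinity>"
    and cap: "\<And>E. compact E \<Longrightarrow> emeasure M E \<le> ennreal C * cap \<alpha> p E"
    and e: "0 \<le> e"
    and energy: "\<And>N :: 'a measure. finite_measure N \<Longrightarrow> sets N = sets borel \<Longrightarrow>
        (\<forall>E. compact E \<longrightarrow> emeasure N E \<le> ennreal C * cap \<alpha> p E) \<Longrightarrow>
        (\<integral>\<^sup>+ x. dpot d e N x \<partial>N) \<le> ennreal A * emeasure N (space N)"
  shows "(\<integral>\<^sup>+ y. dlow d e M k y * indicator (ball z (2 powr k)) y \<partial>M)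
    \<le> ennreal A * emeasure M (ball z (2 powr (k + 1)))"
proof -
  define B where "B = ball z (2 powr (k + 1))"
  define N where "N = density M (indicator B)"
  have B [measurable]: "B \<in> sets borel" by (simp add: B_def)
  have sp: "space M = UNIV" using sets_eq_imp_space_eq[OF M] by simp
  have N: "emeasure N E = emeasure M (E \<inter> B)" if "E \<in> sets borel" for E
    unfolding N_def using that
    by (subst emeasure_density) (auto simp: M nn_integral_indicator simp flip: indicator_inter_arith
        intro!: arg_cong[where f = "emeasure M"])
  have NB: "emeasure N (space N) = emeasure M B"
    using N[of UNIV] by (simp add: N_def sp)
  have "emeasure M B \<le> emeasure M (cball z (2 powr (k + 1)))"
    unfolding B_def by (intro emeasure_mono) (auto simp: M)
  also have "\<dots> < \<infinity>" by (rule fin) simp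
  finally have "finite_measure N" using NB by (intro finite_measureI) auto
  moreover have "sets N = sets borel" by (simp add: N_def M)
  moreover have "emeasure N E \<le> ennreal C * cap \<alpha> p E" if "compact E" for E
  proof -
    have "E \<in> sets borel" using that by (simp add: borel_compact)
    then have "emeasure N E \<le> emeasure M E" by (simp add: N) (intro emeasure_mono, auto simp: M)
    then show ?thesis using cap[OF that] by simp
  qed
  ultimately have En: "(\<integral>\<^sup>+ x. dpot d e N x \<partial>N) \<le> ennreal A * emeasure N (space N)"
    by (intro energy) auto
  have "(\<integral>\<^sup>+ y. dlow d e M k y * indicator (ball z (2 powr k)) y \<partial>M)
     \<le> (\<integral>\<^sup>+ y. indicator B y * dpot d e N y \<partial>M)"
  proof (intro nn_integral_mono)
    fix y
    show "dlow d e M k y * indicator (ball z (2 powr k)) y \<le> indicator B y * dpot d e N y"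
    proof (cases "y \<in> ball z (2 powr k)")
      case True
      have "dterm d e M j y * indicator {..k} j \<le> dterm d e N j y" for j
      proof (cases "j \<le> k")
        case jk: True
        have "ball y (2 powr j) \<inter> B = ball y (2 powr j)"
          using ball_powr_subset[OF True, of "k + 1" j] jk by (auto simp: B_def)
        then show ?thesis by (simp add: dterm_def N indicator_def)
      qed simp
      then have "dlow d e M k y \<le> dpot d e N y" by (rule zsum_mono)
      moreover have "y \<in> B"
        using True subset_ball[of "2 powr k" "2 powr (k + 1)" z] by (auto simp: B_def)
      ultimately show ?thesis using True by simp
    qed simp
  qed
  also have "\<dots> = (\<integral>\<^sup>+ x. dpot d e N x \<partial>N)"
  proof -
    have "sigma_finite_measure N"
      using \<open>finite_measure N\<close> by (simp add: finite_measure.axioms(1))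
    then have "dterm d e N k \<in> borel_measurable borel" for k
      by (intro borel_measurable_dterm) (auto simp: N_def M)
    then have "(\<lambda>x. dpot d e N x) \<in> borel_measurable borel"
      by (rule borel_measurable_zsum)
    then have [measurable]: "(\<lambda>x. dpot d e N x) \<in> borel_measurable M"
      by (simp add: measurable_cong_sets[OF M refl])
    show ?thesis
      by (intro nn_integral_density[of "indicator B" M "\<lambda>x. dpot d e N x", folded N_def, symmetric])
         (auto simp: measurable_cong_sets[OF M refl])
  qed
  also have "\<dots> \<le> ennreal A * emeasure M B" using En NB by simp
  finally show ?thesis unfolding B_def .
qed

text \<open>Averaging over w in B(y,2^j) trades the factor \<open>dterm\<close> at y for a quantity
  at w, which leaves the integral over y. What remains is the integral of F over B(w,2^j), to which
  the assumed bound applies, and a second use of Fubini turns the resulting mass back into an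
  integral over points. The cost is a volume ratio 2^(cn) and a rescaling 2^(d(c+1)e).\<close>

lemma peel_average:
  fixes M :: "'a::euclidean_space measure" and j k c :: int and d e :: real
  assumes sf: "sigma_finite_measure M" and M [measurable_cong]: "sets M = sets borel"
    and d: "0 < d" and e: "0 < e" and c: "1 \<le> c" and jk: "j \<le> k"
    and F [measurable]: "F \<in> borel_measurable borel"
    and bound: "\<And>w. (\<integral>\<^sup>+ y. F y * indicator (ball w (2 powr j)) y \<partial>M)
       \<le> a * emeasure M (ball w (2 powr (j + c)))"
  shows "(\<integral>\<^sup>+ y. dterm d e M j y * F y * indicator (ball z (2 powr k)) y \<partial>M)
    \<le> ennreal (2 powr (c * real DIM('a)) * 2 powr (d * (c + 1) * e)) * a *
       (\<integral>\<^sup>+ y. dterm d e M (j + (c + 1)) y * indicator (ball z (2 powr (k + (c + 1)))) y \<partial>M)"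
proof -
  interpret M: sigma_finite_measure M by fact
  interpret pair_sigma_finite M "lborel :: 'a measure"
    by (intro pair_sigma_finite.intro sf sigma_finite_lborel)
  note [measurable] = borel_measurable_emeasure_ball[OF sf M] borel_measurable_dterm[OF sf M]
  let ?n = "real DIM('a)"
  define v where "v = unit_ball_vol ?n * 2 powr (j * ?n)"
  have v: "0 < v" by (simp add: v_def)
  have vol: "emeasure lborel (ball y (2 powr j)) = ennreal v" for y :: 'a
    unfolding v_def by (rule emeasure_ball_powr)
  have volc: "emeasure lborel (ball y (2 powr (j + c))) = ennreal (v * 2 powr (c * ?n))" for y :: 'a
  proof -
    have *: "real_of_int (j + c) * ?n = j * ?n + c * ?n" by (simp add: algebra_simps)
    show ?thesis unfolding emeasure_ball_powr * powr_add v_def by (simp add: mult_ac)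
  qed
  let ?J = "\<lambda>i w. indicator (ball w (2 powr real_of_int i)) :: 'a \<Rightarrow> ennreal"
  \<comment> \<open>The normalisation stays at scale j while the radius varies, so that h is
    monotone under inclusion of balls.\<close>
  define h where "h i w = (emeasure M (ball w (2 powr real_of_int i)) * ennreal (2 powr (- (d * j)))) powe e" for i w
  have [measurable]: "h i \<in> borel_measurable borel" for i
    unfolding h_def by measurable
  have h_mono: "h i x \<le> h l y" if "ball x (2 powr i) \<subseteq> ball y (2 powr l)" for i l x y
    unfolding h_def using that e by (intro powe_mono mult_right_mono emeasure_mono) (auto simp: M)
  have hd: "dterm d e M j y = h j y" for y unfolding h_def dterm_def ..
  have "ennreal v * (\<integral>\<^sup>+ y. dterm d e M j y * F y * ?J k z y \<partial>M)
    = (\<integral>\<^sup>+ y. ennreal v * (dterm d e M j y * F y * ?J k z y) \<partial>M)"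
    by (rule nn_integral_cmult[symmetric]) measurable
  also have "\<dots> = (\<integral>\<^sup>+ y. \<integral>\<^sup>+ w. h j y * F y * ?J k z y * ?J j y w \<partial>lborel \<partial>M)"
    by (intro nn_integral_cong, subst nn_integral_cmult_indicator) (auto simp: vol hd mult_ac)
  also have "\<dots> = (\<integral>\<^sup>+ w. \<integral>\<^sup>+ y. h j y * F y * ?J k z y * ?J j y w \<partial>M \<partial>lborel)"
    by (rule Fubini'[symmetric]) measurable
  also have "\<dots> \<le> (\<integral>\<^sup>+ w. \<integral>\<^sup>+ y. ?J (k + 1) z w * h (j + 1) w * (F y * ?J j w y) \<partial>M \<partial>lborel)"
  proof (intro nn_integral_mono)
    fix w y
    show "h j y * F y * ?J k z y * ?J j y w \<le> ?J (k + 1) z w * h (j + 1) w * (F y * ?J j w y)"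
    proof (cases "y \<in> ball z (2 powr k) \<and> w \<in> ball y (2 powr j)")
      case True
      then have "w \<in> ball z (2 powr (k + 1))"
        using ball_powr_subset[of y z k "k + 1" j] jk by auto
      moreover have y: "y \<in> ball w (2 powr j)" using True by (simp add: dist_commute)
      moreover have "h j y \<le> h (j + 1) w"
        using ball_powr_subset[OF y, of "j + 1" j] by (intro h_mono) auto
      ultimately show ?thesis using True by (simp add: mult_right_mono)
    qed auto
  qed
  also have "\<dots> = (\<integral>\<^sup>+ w. ?J (k + 1) z w * h (j + 1) w * (\<integral>\<^sup>+ y. F y * ?J j w y \<partial>M) \<partial>lborel)"
    by (intro nn_integral_cong nn_integral_cmult) measurable
  also have "\<dots> \<le> (\<integral>\<^sup>+ w. ?J (k + 1) z w * h (j + 1) w * (a * emeasure M (ball w (2 powr (j + c)))) \<partial>lborel)"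
    by (intro nn_integral_mono mult_left_mono bound) auto
  also have "\<dots> = (\<integral>\<^sup>+ w. a * (\<integral>\<^sup>+ y. ?J (k + 1) z w * h (j + 1) w * ?J (j + c) w y \<partial>M) \<partial>lborel)"
    by (intro nn_integral_cong, subst nn_integral_cmult_indicator) (auto simp: M mult_ac)
  also have "\<dots> = a * (\<integral>\<^sup>+ w. \<integral>\<^sup>+ y. ?J (k + 1) z w * h (j + 1) w * ?J (j + c) w y \<partial>M \<partial>lborel)"
    by (rule nn_integral_cmult) measurable
  \<comment> \<open>Now y ranges over B(w,2^(j+c)). Both B(w,2^(j+1)) and the position of y relative
    to z fit after an enlargement by c more scales, which uses c \<ge> 1.\<close>
  also have "\<dots> \<le> a * (\<integral>\<^sup>+ w. \<integral>\<^sup>+ y. ?J (k + (c + 1)) z y * h (j + (c + 1)) y * ?J (j + c) y w \<partial>M \<partial>lborel)"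
  proof (intro nn_integral_mono mult_left_mono)
    fix w y
    show "?J (k + 1) z w * h (j + 1) w * ?J (j + c) w y
      \<le> ?J (k + (c + 1)) z y * h (j + (c + 1)) y * ?J (j + c) y w"
    proof (cases "w \<in> ball z (2 powr (k + 1)) \<and> y \<in> ball w (2 powr (j + c))")
      case True
      then have "y \<in> ball z (2 powr (k + (c + 1)))"
        using ball_powr_subset[of w z "k + 1" "k + (c + 1)" "j + c"] jk c by auto
      moreover have w: "w \<in> ball y (2 powr (j + c))" using True by (simp add: dist_commute)
      moreover have "h (j + 1) w \<le> h (j + (c + 1)) y"
        using ball_powr_subset[OF w, of "j + (c + 1)" "j + 1"] c by (intro h_mono) auto
      ultimately show ?thesis using True by simp
    qed auto
  qed auto
  also have "(\<integral>\<^sup>+ w. \<integral>\<^sup>+ y. ?J (k + (c + 1)) z y * h (j + (c + 1)) y * ?J (j + c) y w \<partial>M \<partial>lborel)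
    = (\<integral>\<^sup>+ y. \<integral>\<^sup>+ w. ?J (k + (c + 1)) z y * h (j + (c + 1)) y * ?J (j + c) y w \<partial>lborel \<partial>M)"
    by (rule Fubini') measurable
  also have "\<dots> = (\<integral>\<^sup>+ y. ennreal (v * 2 powr (c * ?n)) * ennreal (2 powr (d * (c + 1) * e)) *
      (dterm d e M (j + (c + 1)) y * ?J (k + (c + 1)) z y) \<partial>M)"
  proof (intro nn_integral_cong)
    fix y
    have hj: "h (j + (c + 1)) y = ennreal (2 powr (d * (c + 1) * e)) * dterm d e M (j + (c + 1)) y"
    proof -
      have *: "- (d * j * e) = d * (c + 1) * e + - (d * (j + (c + 1)) * e)"
        by (simp add: algebra_simps)
      have "h (j + (c + 1)) y = emeasure M (ball y (2 powr (j + (c + 1)))) powe e * ennreal (2 powr (- (d * j * e)))"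
        by (simp add: h_def powe_mult powe_ennreal powr_powr)
      then show ?thesis
        unfolding dterm_eq * powr_add by (simp add: ennreal_mult mult_ac)
    qed
    have "(\<integral>\<^sup>+ w. ?J (k + (c + 1)) z y * h (j + (c + 1)) y * ?J (j + c) y w \<partial>lborel)
      = ?J (k + (c + 1)) z y * h (j + (c + 1)) y * ennreal (v * 2 powr (c * ?n))"
      by (subst nn_integral_cmult_indicator) (auto simp: volc simp del: of_int_add)
    then show "(\<integral>\<^sup>+ w. ?J (k + (c + 1)) z y * h (j + (c + 1)) y * ?J (j + c) y w \<partial>lborel)
      = ennreal (v * 2 powr (c * ?n)) * ennreal (2 powr (d * (c + 1) * e)) *
      (dterm d e M (j + (c + 1)) y * ?J (k + (c + 1)) z y)" by (simp only: hj mult_ac)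
  qed
  also have "\<dots> = ennreal (v * 2 powr (c * ?n)) * ennreal (2 powr (d * (c + 1) * e)) *
      (\<integral>\<^sup>+ y. dterm d e M (j + (c + 1)) y * ?J (k + (c + 1)) z y \<partial>M)"
    by (rule nn_integral_cmult) measurable
  finally have "ennreal v * (\<integral>\<^sup>+ y. dterm d e M j y * F y * ?J k z y \<partial>M)
    \<le> ennreal v * (ennreal (2 powr (c * ?n) * 2 powr (d * (c + 1) * e)) * a *
       (\<integral>\<^sup>+ y. dterm d e M (j + (c + 1)) y * ?J (k + (c + 1)) z y \<partial>M))"
    using v by (simp add: ennreal_mult mult_ac)
  then show ?thesis
    using v by (subst (asm) ennreal_mult_le_mult_iff) auto
qed

text \<open>The right side carries the mass of an enlarged ball, with an enlargement c independent
  of centre and scale; the measure is not assumed to be doubling.\<close>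

definition dlow_moment_le :: "real \<Rightarrow> real \<Rightarrow> 'a::euclidean_space measure \<Rightarrow> real \<Rightarrow> real \<Rightarrow> int \<Rightarrow> bool" where
  "dlow_moment_le d e M s A c \<longleftrightarrow> (\<forall>z (k::int).
     (\<integral>\<^sup>+ y. dlow d e M k y powe s * indicator (ball z (2 powr k)) y \<partial>M)
       \<le> ennreal A * emeasure M (ball z (2 powr (k + c))))"

lemma dlow_moment_leI:
  "(\<And>z (k::int). (\<integral>\<^sup>+ y. dlow d e M k y powe s * indicator (ball z (2 powr k)) y \<partial>M)
       \<le> ennreal A * emeasure M (ball z (2 powr (k + c)))) \<Longrightarrow> dlow_moment_le d e M s A c"
  unfolding dlow_moment_le_def by blast

lemma dlow_moment_leD:
  fixes k :: int
  shows "dlow_moment_le d e M s A c \<Longrightarrow>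
    (\<integral>\<^sup>+ y. dlow d e M k y powe s * indicator (ball z (2 powr k)) y \<partial>M)
       \<le> ennreal A * emeasure M (ball z (2 powr (k + c)))"
  unfolding dlow_moment_le_def by blast

text \<open>Induction on m. Summation by parts writes the power m + 1 as a sum over the largest
  scale j of \<open>dterm\<close> times the m-th power of the potential truncated at j. By
  \<open>peel_average\<close> and the induction hypothesis the m-th power is replaced by a constant,
  leaving a first moment at scale k + c + 1. Its bound by A adds one more scale, so c becomes c +
  2.\<close>

lemma local_moments:
  fixes d e A :: real
  assumes d: "0 < d" and e: "0 < e" and A: "0 < A" and m: "1 \<le> m"
  shows "\<exists>A'>0. \<exists>c\<ge>1. \<forall>M :: 'a::euclidean_space measure. sigma_finite_measure M \<longrightarrow> sets M = sets borel \<longrightarrow>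
    dlow_moment_le d e M 1 A 1 \<longrightarrow> dlow_moment_le d e M (real m) A' c"
  using m
proof (induction m rule: dec_induct)
  case base
  show ?case unfolding of_nat_1 using A by blast
next
  case (step m)
  let ?n = "real DIM('a)"
  from step obtain A' :: real and c :: int where A': "0 < A'" and c: "1 \<le> c" and
    IH: "\<And>M :: 'a measure. sigma_finite_measure M \<Longrightarrow> sets M = sets borel \<Longrightarrow>
    dlow_moment_le d e M 1 A 1 \<Longrightarrow> dlow_moment_le d e M (real m) A' c"
    by blast
  define L where "L = 2 powr (c * ?n) * 2 powr (d * (c + 1) * e)"
  have L: "0 < L" by (simp add: L_def)
  show ?case
  proof (intro exI[of _ "(real m + 1) * (L * A') * A"] exI[of _ "c + 2"] conjI allI impI)
    show "0 < (real m + 1) * (L * A') * A" using L A A' by simp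
    show "1 \<le> c + 2" using c by simp
    fix M :: "'a measure"
    assume sf: "sigma_finite_measure M" and M [measurable_cong]: "sets M = sets borel"
      and H: "dlow_moment_le d e M 1 A 1"
    show "dlow_moment_le d e M (real (Suc m)) ((real m + 1) * (L * A') * A) (c + 2)"
    proof (rule dlow_moment_leI)
      fix z :: 'a and k :: int
      note [measurable] = borel_measurable_dterm[OF sf M]
      have lm [measurable]: "(\<lambda>y. dlow d e M j y) \<in> borel_measurable borel" for j
        by (intro borel_measurable_zsum) measurable
      let ?B = "indicator (ball z (2 powr k)) :: 'a \<Rightarrow> ennreal"
      let ?k' = "k + (c + 1)"
      let ?B' = "indicator (ball z (2 powr ?k')) :: 'a \<Rightarrow> ennreal"
      have "(\<integral>\<^sup>+ y. dlow d e M k y powe (real (Suc m)) * ?B y \<partial>M)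
        \<le> (\<integral>\<^sup>+ y. ennreal (real m + 1) *
             zsum (\<lambda>j. (dterm d e M j y * dlow d e M j y powe (real m) * ?B y) * indicator {..k} j) \<partial>M)"
      proof (intro nn_integral_mono)
        fix y
        have "dlow d e M k y powe (real (Suc m)) = dlow d e M k y powe (real m + 1)"
          by (simp add: add.commute)
        also have "\<dots> \<le> ennreal (real m + 1) * zsum (\<lambda>j. dterm d e M j y * indicator {..k} j *
            zsum (\<lambda>i. dterm d e M i y * indicator {..k} i * indicator {..j} i) powe (real m))"
          using step by (intro zsum_powe_le) auto
        \<comment> \<open>For j \<le> k the truncation at j already implies the one at k.\<close>
        also have "(\<lambda>j. dterm d e M j y * indicator {..k} j *
            zsum (\<lambda>i. dterm d e M i y * indicator {..k} i * indicator {..j} i) powe (real m))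
          = (\<lambda>j. (dterm d e M j y * dlow d e M j y powe (real m)) * indicator {..k} j)"
        proof
          fix j
          show "dterm d e M j y * indicator {..k} j *
              zsum (\<lambda>i. dterm d e M i y * indicator {..k} i * indicator {..j} i) powe (real m)
            = (dterm d e M j y * dlow d e M j y powe (real m)) * indicator {..k} j"
          proof (cases "j \<le> k")
            case True
            then have "zsum (\<lambda>i. dterm d e M i y * indicator {..k} i * indicator {..j} i) = dlow d e M j y"
              by (intro nn_integral_cong) (auto simp: indicator_def)
            then show ?thesis using True by simp
          qed simp
        qed
        finally have "dlow d e M k y powe (real (Suc m)) * ?B y
          \<le> ennreal (real m + 1) * zsum (\<lambda>j. (dterm d e M j y * dlow d e M j y powe (real m)) * indicator {..k} j) * ?B y"
          by (rule mult_right_mono) simp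
        then show "dlow d e M k y powe (real (Suc m)) * ?B y \<le> ennreal (real m + 1) *
             zsum (\<lambda>j. (dterm d e M j y * dlow d e M j y powe (real m) * ?B y) * indicator {..k} j)"
          by (cases "y \<in> ball z (2 powr k)") auto
      qed
      also have "\<dots> = ennreal (real m + 1) *
           (\<integral>\<^sup>+ y. zsum (\<lambda>j. (dterm d e M j y * dlow d e M j y powe (real m) * ?B y) * indicator {..k} j) \<partial>M)"
        by (intro nn_integral_cmult borel_measurable_zsum) measurable
      also have "(\<integral>\<^sup>+ y. zsum (\<lambda>j. (dterm d e M j y * dlow d e M j y powe (real m) * ?B y) * indicator {..k} j) \<partial>M)
        = zsum (\<lambda>j. \<integral>\<^sup>+ y. (dterm d e M j y * dlow d e M j y powe (real m) * ?B y) * indicator {..k} j \<partial>M)"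
        by (rule zsum_swap) measurable
      also have "\<dots> \<le> zsum (\<lambda>j. ennreal L * ennreal A' *
           (\<integral>\<^sup>+ y. dterm d e M (j + (c + 1)) y * ?B' y * indicator {..?k'} (j + (c + 1)) \<partial>M))"
      proof (rule zsum_mono)
        fix j
        show "(\<integral>\<^sup>+ y. (dterm d e M j y * dlow d e M j y powe (real m) * ?B y) * indicator {..k} j \<partial>M)
          \<le> ennreal L * ennreal A' *
           (\<integral>\<^sup>+ y. dterm d e M (j + (c + 1)) y * ?B' y * indicator {..?k'} (j + (c + 1)) \<partial>M)"
        proof (cases "j \<le> k")
          case True
          show ?thesis
            using peel_average[OF sf M d e c True, of "\<lambda>y. dlow d e M j y powe (real m)" "ennreal A'" z]
              dlow_moment_leD[OF IH[OF sf M H], of j] True unfolding L_def by simp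
        qed simp
      qed
      also have "\<dots> = ennreal L * ennreal A' *
         zsum (\<lambda>j. \<integral>\<^sup>+ y. dterm d e M j y * ?B' y * indicator {..?k'} j \<partial>M)"
        unfolding zsum_cmult by (subst zsum_shift) rule
      also have "zsum (\<lambda>j. \<integral>\<^sup>+ y. dterm d e M j y * ?B' y * indicator {..?k'} j \<partial>M)
        = (\<integral>\<^sup>+ y. zsum (\<lambda>j. dterm d e M j y * ?B' y * indicator {..?k'} j) \<partial>M)"
        by (rule zsum_swap[symmetric]) measurable
      also have "\<dots> = (\<integral>\<^sup>+ y. dlow d e M ?k' y * ?B' y \<partial>M)"
        by (intro nn_integral_cong) (auto simp: indicator_def)
      also have "\<dots> \<le> ennreal A * emeasure M (ball z (2 powr (?k' + 1)))"
        using dlow_moment_leD[OF H, of ?k' z] by simp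
      finally have "(\<integral>\<^sup>+ y. dlow d e M k y powe (real (Suc m)) * ?B y \<partial>M)
        \<le> ennreal (real m + 1) * (ennreal L * ennreal A' * (ennreal A * emeasure M (ball z (2 powr (?k' + 1)))))"
        by (simp add: mult_left_mono)
      also have "\<dots> = ennreal ((real m + 1) * (L * A') * A) * emeasure M (ball z (2 powr (k + (c + 2))))"
      proof -
        have "?k' + 1 = k + (c + 2)" by simp
        moreover have "ennreal ((real m + 1) * (L * A') * A) = ennreal (real m + 1) * (ennreal L * ennreal A') * ennreal A"
          using L A A' by (simp add: ennreal_mult del: ennreal_plus)
        ultimately show ?thesis by (simp only: mult.assoc)
      qed
      finally show "(\<integral>\<^sup>+ y. dlow d e M k y powe (real (Suc m)) * ?B y \<partial>M)
        \<le> ennreal ((real m + 1) * (L * A') * A) * emeasure M (ball z (2 powr (k + (c + 2))))" .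
    qed
  qed
qed

text \<open>An integer m \<ge> s reduces to the previous case by a^s \<le> 1 + a^m; the term 1 only
  adds the mass of the ball itself.\<close>

lemma dlow_moment_le_powe:
  fixes d e A s :: real
  assumes d: "0 < d" and e: "0 < e" and A: "0 < A" and s: "0 < s"
  shows "\<exists>A'>0. \<exists>c\<ge>1. \<forall>M :: 'a::euclidean_space measure. sigma_finite_measure M \<longrightarrow> sets M = sets borel \<longrightarrow>
    dlow_moment_le d e M 1 A 1 \<longrightarrow> dlow_moment_le d e M s A' c"
proof -
  obtain m :: nat where "s \<le> real m" using real_arch_simple by blast
  then have m: "s \<le> real m" "1 \<le> m" using s by (auto simp: Suc_le_eq intro: gr0I)
  obtain A' c where A': "0 < A'" and c: "1 \<le> c" and
    mom: "\<And>M :: 'a measure. sigma_finite_measure M \<Longrightarrow> sets M = sets borel \<Longrightarrow>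
    dlow_moment_le d e M 1 A 1 \<Longrightarrow> dlow_moment_le d e M (real m) A' c"
    using local_moments[OF d e A m(2)] by blast
  show ?thesis
  proof (intro exI[of _ "1 + A'"] exI[of _ c] conjI allI impI)
    fix M :: "'a measure"
    assume sf: "sigma_finite_measure M" and M [measurable_cong]: "sets M = sets borel"
      and H: "dlow_moment_le d e M 1 A 1"
    note [measurable] = borel_measurable_dterm[OF sf M]
    have [measurable]: "(\<lambda>y. dlow d e M j y) \<in> borel_measurable borel" for j
      by (intro borel_measurable_zsum) measurable
    show "dlow_moment_le d e M s (1 + A') c"
    proof (rule dlow_moment_leI)
      fix z :: 'a and k :: int
      let ?B = "indicator (ball z (2 powr k)) :: 'a \<Rightarrow> ennreal"
      have "(\<integral>\<^sup>+ y. dlow d e M k y powe s * ?B y \<partial>M)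
         \<le> (\<integral>\<^sup>+ y. ?B y + dlow d e M k y powe (real m) * ?B y \<partial>M)"
      proof (rule nn_integral_mono)
        fix y
        show "dlow d e M k y powe s * ?B y \<le> ?B y + dlow d e M k y powe (real m) * ?B y"
          using powe_le_one_add[OF s m(1), of "dlow d e M k y"] by (auto simp: indicator_def)
      qed
      also have "\<dots> = emeasure M (ball z (2 powr k)) + (\<integral>\<^sup>+ y. dlow d e M k y powe (real m) * ?B y \<partial>M)"
        by (subst nn_integral_add) (auto simp: M)
      also have "\<dots> \<le> emeasure M (ball z (2 powr (k + c))) + ennreal A' * emeasure M (ball z (2 powr (k + c)))"
        using c by (intro add_mono dlow_moment_leD[OF mom[OF sf M H]] emeasure_mono subset_ball powr_mono)
          (auto simp: M)
      also have "\<dots> = ennreal (1 + A') * emeasure M (ball z (2 powr (k + c)))"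
        using A' by (simp add: distrib_right)
      finally show "(\<integral>\<^sup>+ y. dlow d e M k y powe s * ?B y \<partial>M)
        \<le> ennreal (1 + A') * emeasure M (ball z (2 powr (k + c)))" .
    qed
  qed (use A' c in auto)
qed

section \<open>From truncated to full potentials\<close>

abbreviation dtail :: "real \<Rightarrow> real \<Rightarrow> 'a::euclidean_space measure \<Rightarrow> int \<Rightarrow> 'a \<Rightarrow> ennreal" where
  "dtail d e M k x \<equiv> zsum (\<lambda>j. dterm d e M j x * indicator {k..} j)"

text \<open>Changing the centre costs c scales, and renormalising from scale j to j + c costs
  2^(dce).\<close>

lemma dterm_shift_le:
  fixes M :: "'a::euclidean_space measure" and j c :: int and d e :: real
  assumes M: "sets M = sets borel" and e: "0 \<le> e"
    and sub: "ball y (2 powr j) \<subseteq> ball x (2 powr (j + c))"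
  shows "dterm d e M j y \<le> ennreal (2 powr (d * c * e)) * dterm d e M (j + c) x"
proof -
  have "dterm d e M j y \<le> emeasure M (ball x (2 powr (j + c))) powe e * ennreal (2 powr (- (d * j * e)))"
    unfolding dterm_eq using sub e by (intro mult_right_mono powe_mono emeasure_mono) (auto simp: M)
  also have "- (d * j * e) = d * c * e + - (d * (j + c) * e)"
    by (simp add: algebra_simps)
  also have "emeasure M (ball x (2 powr (j + c))) powe e * ennreal (2 powr (d * c * e + - (d * (j + c) * e)))
    = ennreal (2 powr (d * c * e)) * dterm d e M (j + c) x"
    unfolding dterm_eq powr_add by (simp add: ennreal_mult mult_ac)
  finally show ?thesis .
qed

text \<open>Scales up to k are kept at y. At a larger scale j, the ball about y lies in the ball
  about x of twice the radius, so these terms are controlled by the tail at x.\<close>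

lemma dpot_split:
  fixes M :: "'a::euclidean_space measure" and k :: int
  assumes M: "sets M = sets borel" and e: "0 \<le> e" and y: "y \<in> ball x (2 powr k)"
  shows "dpot d e M y \<le> dlow d e M k y + ennreal (2 powr (d * e)) * dtail d e M (k + 1) x"
proof -
  have "dpot d e M y \<le> zsum (\<lambda>j. dterm d e M j y * indicator {..k} j +
      ennreal (2 powr (d * e)) * (dterm d e M (j + 1) x * indicator {k + 1..} (j + 1)))"
  proof (rule zsum_mono)
    fix j
    show "dterm d e M j y \<le> dterm d e M j y * indicator {..k} j +
      ennreal (2 powr (d * e)) * (dterm d e M (j + 1) x * indicator {k + 1..} (j + 1))"
    proof (cases "j \<le> k")
      case False
      then have "dterm d e M j y \<le> ennreal (2 powr (d * (1::int) * e)) * dterm d e M (j + 1) x"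
        by (intro dterm_shift_le[OF M e] ball_powr_subset[OF y]) auto
      then show ?thesis using False by simp
    qed (simp add: add_increasing2)
  qed
  also have "\<dots> = dlow d e M k y + ennreal (2 powr (d * e)) *
      zsum (\<lambda>j. dterm d e M (j + 1) x * indicator {k + 1..} (j + 1))"
    unfolding zsum_add zsum_cmult ..
  also have "zsum (\<lambda>j. dterm d e M (j + 1) x * indicator {k + 1..} (j + 1)) = dtail d e M (k + 1) x"
    by (rule zsum_shift)
  finally show ?thesis .
qed

text \<open>The tail at x is constant on the ball, so only the truncated part needs the moment
  bound.\<close>

lemma dpot_moment_ball:
  fixes M :: "'a::euclidean_space measure" and k c :: int
  assumes sf: "sigma_finite_measure M" and M [measurable_cong]: "sets M = sets borel"
    and e: "0 \<le> e" and s: "0 < s" and A': "0 \<le> A'" and mom: "dlow_moment_le d e M s A' c"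
  shows "(\<integral>\<^sup>+ y. dpot d e M y powe s * indicator (ball x (2 powr k)) y \<partial>M)
    \<le> ennreal (2 powr s) * (ennreal A' * emeasure M (ball x (2 powr (k + c))) +
        ennreal (2 powr (d * e * s)) * dtail d e M (k + 1) x powe s * emeasure M (ball x (2 powr k)))"
proof -
  note [measurable] = borel_measurable_dterm[OF sf M]
  have [measurable]: "(\<lambda>y. dlow d e M j y) \<in> borel_measurable borel" for j
    by (intro borel_measurable_zsum) measurable
  let ?B = "indicator (ball x (2 powr k)) :: 'a \<Rightarrow> ennreal"
  let ?t = "ennreal (2 powr (d * e * s)) * dtail d e M (k + 1) x powe s"
  have "(\<integral>\<^sup>+ y. dpot d e M y powe s * ?B y \<partial>M)
    \<le> (\<integral>\<^sup>+ y. ennreal (2 powr s) * (dlow d e M k y powe s * ?B y + ?t * ?B y) \<partial>M)"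
  proof (rule nn_integral_mono)
    fix y
    show "dpot d e M y powe s * ?B y \<le> ennreal (2 powr s) * (dlow d e M k y powe s * ?B y + ?t * ?B y)"
    proof (cases "y \<in> ball x (2 powr k)")
      case True
      have "dpot d e M y powe s \<le> (dlow d e M k y + ennreal (2 powr (d * e)) * dtail d e M (k + 1) x) powe s"
        using s by (intro powe_mono dpot_split[OF M e True]) auto
      also have "\<dots> \<le> ennreal (2 powr s) * (dlow d e M k y powe s + (ennreal (2 powr (d * e)) * dtail d e M (k + 1) x) powe s)"
        using s by (intro powe_add_le) auto
      also have "(ennreal (2 powr (d * e)) * dtail d e M (k + 1) x) powe s = ?t"
        by (simp add: powe_mult powe_ennreal powr_powr)
      finally show ?thesis using True by simp
    qed simp
  qed
  also have "\<dots> = ennreal (2 powr s) * ((\<integral>\<^sup>+ y. dlow d e M k y powe s * ?B y \<partial>M) + ?t * emeasure M (ball x (2 powr k)))"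
    by (subst nn_integral_cmult, measurable, subst nn_integral_add, measurable, subst nn_integral_cmult_indicator)
       (auto simp: M)
  also have "\<dots> \<le> ennreal (2 powr s) * (ennreal A' * emeasure M (ball x (2 powr (k + c))) + ?t * emeasure M (ball x (2 powr k)))"
    by (intro mult_left_mono add_mono dlow_moment_leD[OF mom]) auto
  finally show ?thesis .
qed

text \<open>The tail is replaced by the full potential at x, so that the factor in front of the mass
  is independent of k and can be taken out of a sum over scales.\<close>

lemma dpot_moment_ball_dpot:
  fixes M :: "'a::euclidean_space measure" and k c :: int
  assumes sf: "sigma_finite_measure M" and M: "sets M = sets borel"
    and e: "0 \<le> e" and s: "0 < s" and A': "0 \<le> A'" and c: "1 \<le> c" and mom: "dlow_moment_le d e M s A' c"
  shows "(\<integral>\<^sup>+ y. dpot d e M y powe s * indicator (ball x (2 powr k)) y \<partial>M)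
    \<le> ennreal (2 powr s * (A' + 2 powr (d * e * s))) * (1 + dpot d e M x powe s) *
        emeasure M (ball x (2 powr (k + c)))"
proof -
  let ?m = "emeasure M (ball x (2 powr (k + c)))"
  let ?D = "dpot d e M x powe s"
  have 1: "dtail d e M (k + 1) x powe s \<le> ?D"
    using s by (intro powe_mono zsum_mono) (auto simp: indicator_def)
  have 2: "emeasure M (ball x (2 powr k)) \<le> ?m"
    using c by (intro emeasure_mono subset_ball powr_mono) (auto simp: M)
  have "(\<integral>\<^sup>+ y. dpot d e M y powe s * indicator (ball x (2 powr k)) y \<partial>M)
    \<le> ennreal (2 powr s) * (ennreal A' * ?m + ennreal (2 powr (d * e * s)) * ?D * ?m)"
    by (intro order_trans[OF dpot_moment_ball[OF sf M e s A' mom]] mult_left_mono add_mono mult_mono 1 2) auto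
  also have "\<dots> \<le> ennreal (2 powr s) * (ennreal A' * (1 + ?D) * ?m + ennreal (2 powr (d * e * s)) * (1 + ?D) * ?m)"
  proof (intro mult_left_mono add_mono mult_right_mono)
    have "ennreal A' * 1 \<le> ennreal A' * (1 + ?D)" by (intro mult_left_mono) auto
    then show "ennreal A' \<le> ennreal A' * (1 + ?D)" by simp
  qed auto
  also have "\<dots> = ennreal (2 powr s * (A' + 2 powr (d * e * s))) * (1 + ?D) * ?m"
    using A' by (simp add: ennreal_mult distrib_left distrib_right mult_ac)
  finally show ?thesis .
qed

text \<open>On \<open>B(x,2\<^sup>k)\<close> the potential dominates the tail at \<open>x\<close> of the scales from \<open>k\<close> on, and
  summation by parts turns the tails into a power of the full sum.\<close>

lemma dpot_density_ge:
  fixes M :: "'a::euclidean_space measure"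
  assumes sf: "sigma_finite_measure M" and M [measurable_cong]: "sets M = sets borel"
    and d: "0 < d" and e: "0 < e" and s: "0 < s"
  shows "dpot d e M x powe (s * e + 1)
    \<le> ennreal (2 powr (d * e * s * e) * (s * e + 1)) * dpot d e (density M (\<lambda>y. dpot d e M y powe s)) x"
proof -
  note [measurable] = borel_measurable_dterm[OF sf M]
  have [measurable]: "(\<lambda>y. dpot d e M y) \<in> borel_measurable borel"
    by (intro borel_measurable_zsum) measurable
  let ?N = "density M (\<lambda>y. dpot d e M y powe s)"
  let ?b = "2 powr (d * e)"
  have tail: "dtail d e M k x \<le> ennreal ?b * dpot d e M y" if "y \<in> ball x (2 powr k)" for k :: int and y
  proof -
    have "x \<in> ball y (2 powr k)" using that by (simp add: dist_commute)
    then have "dterm d e M j x \<le> ennreal (2 powr (d * (1::int) * e)) * dterm d e M (j + 1) y" if "k \<le> j" for j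
      using that by (intro dterm_shift_le[OF M less_imp_le[OF e]] ball_powr_subset) auto
    then have "dtail d e M k x \<le> zsum (\<lambda>j. ennreal ?b * dterm d e M (j + 1) y)"
      by (intro zsum_mono) (auto simp: indicator_def)
    also have "\<dots> = ennreal ?b * dpot d e M y"
      unfolding zsum_cmult by (subst zsum_shift) rule
    finally show ?thesis .
  qed
  \<comment> \<open>Before taking the power e this says that the density gives the ball at least a
    multiple of \<open>dtail\<close> to the s times its M-mass.\<close>
  have each: "dterm d e M k x * dtail d e M k x powe (s * e) \<le> ennreal (2 powr (d * e * s * e)) * dterm d e ?N k x" for k
  proof -
    let ?B = "ball x (2 powr k)"
    have "dtail d e M k x powe s * emeasure M ?B = (\<integral>\<^sup>+ y. dtail d e M k x powe s * indicator ?B y \<partial>M)"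
      by (subst nn_integral_cmult_indicator) (auto simp: M)
    also have "\<dots> \<le> (\<integral>\<^sup>+ y. ennreal (2 powr (d * e * s)) * (dpot d e M y powe s * indicator ?B y) \<partial>M)"
    proof (rule nn_integral_mono)
      fix y
      have "dtail d e M k x powe s \<le> (ennreal ?b * dpot d e M y) powe s" if "y \<in> ?B"
        using s by (intro powe_mono tail that) auto
      also have "(ennreal ?b * dpot d e M y) powe s = ennreal (2 powr (d * e * s)) * dpot d e M y powe s"
        by (simp add: powe_mult powe_ennreal powr_powr)
      finally show "dtail d e M k x powe s * indicator ?B y
          \<le> ennreal (2 powr (d * e * s)) * (dpot d e M y powe s * indicator ?B y)"
        by (auto simp: indicator_def)
    qed
    also have "\<dots> = ennreal (2 powr (d * e * s)) * (\<integral>\<^sup>+ y. dpot d e M y powe s * indicator ?B y \<partial>M)"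
      by (rule nn_integral_cmult) measurable
    also have "(\<integral>\<^sup>+ y. dpot d e M y powe s * indicator ?B y \<partial>M) = emeasure ?N ?B"
      by (subst emeasure_density) (auto simp: M)
    finally have "(dtail d e M k x powe s * emeasure M ?B * ennreal (2 powr (- (d * k)))) powe e
      \<le> (ennreal (2 powr (d * e * s)) * emeasure ?N ?B * ennreal (2 powr (- (d * k)))) powe e"
      using e by (intro powe_mono mult_right_mono) auto
    then show ?thesis
      unfolding dterm_def
      by (simp add: powe_mult powe_powe powe_ennreal powr_powr mult_ac)
  qed
  have "dpot d e M x powe (s * e + 1)
      \<le> ennreal (s * e + 1) * zsum (\<lambda>k. dterm d e M k x * dtail d e M k x powe (s * e))"
    using s e by (intro zsum_powe_le_up) auto
  also have "\<dots> \<le> ennreal (s * e + 1) * zsum (\<lambda>k. ennreal (2 powr (d * e * s * e)) * dterm d e ?N k x)"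
    by (intro mult_left_mono zsum_mono each) auto
  also have "\<dots> = ennreal (2 powr (d * e * s * e) * (s * e + 1)) * dpot d e ?N x"
    using s e unfolding zsum_cmult by (simp add: ennreal_mult mult_ac del: ennreal_plus)
  finally show ?thesis .
qed

section \<open>Sub- and supersolutions\<close>

lemma emeasure_density_ball:
  fixes M :: "'a::euclidean_space measure"
  assumes M [measurable_cong]: "sets M = sets borel" and [measurable]: "g \<in> borel_measurable borel"
  shows "emeasure (density M g) (ball x t) = (\<integral>\<^sup>+ y. g y * indicator (ball x t) y \<partial>M)"
  by (subst emeasure_density) (auto simp: M)

lemma wolff_density_mono:
  fixes M :: "'a::euclidean_space measure"
  assumes M: "sets M = sets borel" and p: "1 < p"
    and g: "g \<in> borel_measurable borel" and h: "h \<in> borel_measurable borel" and le: "\<And>y. g y \<le> h y"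
  shows "wolff \<alpha> p (density M g) x \<le> wolff \<alpha> p (density M h) x"
  unfolding wolff_def emeasure_density_ball[OF M g] emeasure_density_ball[OF M h]
  using p le unfolding divide_ennreal_def
  by (intro nn_integral_mono mult_right_mono mult_left_mono powe_mono) auto

lemma dpot_density_cmult:
  fixes M :: "'a::euclidean_space measure"
  assumes M [measurable_cong]: "sets M = sets borel" and g [measurable]: "g \<in> borel_measurable borel"
  shows "dpot d e (density M (\<lambda>y. a * g y)) x = a powe e * dpot d e (density M g) x"
proof -
  have "emeasure (density M (\<lambda>y. a * g y)) (ball x t) = a * emeasure (density M g) (ball x t)" for t
    by (subst (1 2) emeasure_density_ball[OF M]) (auto simp: mult.assoc intro!: nn_integral_cmult)
  then show ?thesis
    unfolding zsum_cmult[symmetric] dterm_def by (simp add: powe_mult mult_ac)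
qed

text \<open>Monotone convergence is used twice, for the ball masses and for the integral over the
  radius; in between, \<open>powe_SUP\<close> carries the supremum through the power.\<close>

lemma wolff_density_SUP:
  fixes M :: "'a::euclidean_space measure" and f :: "nat \<Rightarrow> 'a \<Rightarrow> ennreal"
  assumes M [measurable_cong]: "sets M = sets borel" and p: "1 < p" and q: "0 < q"
    and f [measurable]: "\<And>n. f n \<in> borel_measurable borel"
    and inc: "\<And>n y. f n y \<le> f (Suc n) y"
  shows "wolff \<alpha> p (density M (\<lambda>y. (SUP n. f n y) powe q)) x
    = (SUP n. wolff \<alpha> p (density M (\<lambda>y. f n y powe q)) x)"
proof -
  let ?d = "real DIM('a) - \<alpha> * p" and ?e = "1 / (p - 1)"
  have incf: "incseq (\<lambda>n. f n y)" for y by (rule incseq_SucI) (rule inc)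
  have incq: "f m y powe q \<le> f n y powe q" if "m \<le> n" for m n y
    using q incseqD[OF incf that] by (intro powe_mono) auto
  have ball: "emeasure (density M (\<lambda>y. (SUP n. f n y) powe q)) (ball x t)
      = (SUP n. emeasure (density M (\<lambda>y. f n y powe q)) (ball x t))" for t
  proof -
    have "emeasure (density M (\<lambda>y. (SUP n. f n y) powe q)) (ball x t)
      = (\<integral>\<^sup>+ y. (SUP n. f n y) powe q * indicator (ball x t) y \<partial>M)"
      by (rule emeasure_density_ball[OF M]) measurable
    also have "\<dots> = (\<integral>\<^sup>+ y. (SUP n. f n y powe q * indicator (ball x t) y) \<partial>M)"
      by (intro nn_integral_cong) (auto simp: powe_SUP[OF q] indicator_def)
    also have "\<dots> = (SUP n. \<integral>\<^sup>+ y. f n y powe q * indicator (ball x t) y \<partial>M)"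
      by (intro nn_integral_monotone_convergence_SUP)
         (auto simp: incseq_def le_fun_def incq intro!: mult_right_mono)
    also have "\<dots> = (SUP n. emeasure (density M (\<lambda>y. f n y powe q)) (ball x t))"
      by (intro SUP_cong refl emeasure_density_ball[OF M, symmetric]) measurable
    finally show ?thesis .
  qed
  have kern: "wkern ?d ?e (density M (\<lambda>y. (SUP n. f n y) powe q)) x t
     = (SUP n. wkern ?d ?e (density M (\<lambda>y. f n y powe q)) x t)" for t
    unfolding wkern_def divide_ennreal_def ball using p
    by (simp add: powe_mult powe_SUP SUP_mult_right_ennreal)
  have sm: "sets (density M g) = sets borel" for g by (simp add: M)
  note [measurable] = borel_measurable_wkern[OF sm]
  have "incseq (\<lambda>n t. indicator {0<..} t * wkern ?d ?e (density M (\<lambda>y. f n y powe q)) x t)"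
    unfolding incseq_def le_fun_def wkern_def divide_ennreal_def
  proof (intro allI impI mult_left_mono mult_right_mono powe_mono)
    fix m n :: nat and t assume "m \<le> n"
    then show "emeasure (density M (\<lambda>y. f m y powe q)) (ball x t) \<le> emeasure (density M (\<lambda>y. f n y powe q)) (ball x t)"
      by (subst (1 2) emeasure_density_ball[OF M]) (auto intro!: nn_integral_mono mult_right_mono incq)
  qed (use p in auto)
  then have "(\<integral>\<^sup>+ t. (SUP n. indicator {0<..} t * wkern ?d ?e (density M (\<lambda>y. f n y powe q)) x t) \<partial>lborel)
    = (SUP n. \<integral>\<^sup>+ t. indicator {0<..} t * wkern ?d ?e (density M (\<lambda>y. f n y powe q)) x t \<partial>lborel)"
    by (intro nn_integral_monotone_convergence_SUP) auto
  then show ?thesis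
    unfolding wolff_eq kern by (simp add: SUP_mult_left_ennreal)
qed

text \<open>The iterates of the operator T from w increase because w is a subsolution, and stay
  below v because v is a supersolution. T commutes with increasing suprema, so their supremum is a
  fixed point.\<close>

lemma wolff_solution_between:
  fixes M :: "'a::euclidean_space measure" and w v :: "'a \<Rightarrow> ennreal"
  assumes sf: "sigma_finite_measure M" and M: "sets M = sets borel" and p: "1 < p" and q: "0 < q"
    and w [measurable]: "w \<in> borel_measurable borel" and v [measurable]: "v \<in> borel_measurable borel"
    and wv: "\<And>x. w x \<le> v x"
    and sub: "\<And>x. w x \<le> wolff \<alpha> p (density M (\<lambda>y. w y powe q)) x + b"
    and super: "\<And>x. wolff \<alpha> p (density M (\<lambda>y. v y powe q)) x + b \<le> v x"
  shows "\<exists>u. u \<in> borel_measurable borel \<and> (\<forall>x. w x \<le> u x \<and> u x \<le> v x) \<and>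
    (\<forall>x. u x = wolff \<alpha> p (density M (\<lambda>y. u y powe q)) x + b)"
proof -
  define T where "T f x = wolff \<alpha> p (density M (\<lambda>y. f y powe q)) x + b" for f :: "'a \<Rightarrow> ennreal" and x
  have Tm: "T f \<in> borel_measurable borel" if [measurable]: "f \<in> borel_measurable borel" for f
  proof -
    have [measurable]: "wolff \<alpha> p (density M (\<lambda>y. f y powe q)) \<in> borel_measurable borel"
      by (rule borel_measurable_wolff_density[OF sf M]) measurable
    show ?thesis unfolding T_def by measurable
  qed
  have Tmono: "T f x \<le> T g x" if [measurable]: "f \<in> borel_measurable borel" "g \<in> borel_measurable borel"
    and le: "\<And>y. f y \<le> g y" for f g x
    unfolding T_def using q le
    by (intro add_right_mono wolff_density_mono[OF M p] powe_mono) measurable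
  define U where "U n = (T ^^ n) w" for n
  have U0: "U 0 = w" and US: "U (Suc n) = T (U n)" for n by (simp_all add: U_def)
  have Um [measurable]: "U n \<in> borel_measurable borel" for n
    by (induction n) (auto simp: U0 US w intro: Tm)
  have Uinc: "U n x \<le> U (Suc n) x" for n x
  proof (induction n arbitrary: x)
    case 0
    show ?case using sub by (simp add: U0 US T_def)
  next
    case (Suc n)
    show ?case unfolding US[of "Suc n"] by (subst US) (intro Tmono Um Suc)
  qed
  have Uv: "U n x \<le> v x" for n x
  proof (induction n arbitrary: x)
    case 0
    show ?case by (simp add: U0 wv)
  next
    case (Suc n)
    have "U (Suc n) x \<le> T v x" unfolding US by (intro Tmono Um v Suc)
    also have "\<dots> \<le> v x" unfolding T_def by (rule super)
    finally show ?case .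
  qed
  define u where "u x = (SUP n. U n x)" for x
  have "u x = wolff \<alpha> p (density M (\<lambda>y. u y powe q)) x + b" for x
  proof -
    have "wolff \<alpha> p (density M (\<lambda>y. u y powe q)) x + b
      = (SUP n. wolff \<alpha> p (density M (\<lambda>y. U n y powe q)) x) + b"
      unfolding u_def by (subst wolff_density_SUP[OF M p q]) (auto simp: Uinc)
    also have "\<dots> = (SUP n. U (Suc n) x)"
      unfolding US T_def by (rule ennreal_SUP_add_left[symmetric]) simp
    also have "\<dots> = u x"
      unfolding u_def
    proof (rule antisym)
      show "(SUP n. U (Suc n) x) \<le> (SUP n. U n x)"
        by (rule SUP_mono) blast
      show "(SUP n. U n x) \<le> (SUP n. U (Suc n) x)"
        using Uinc by (intro SUP_mono) blast
    qed
    finally show ?thesis by simp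
  qed
  moreover have "w x \<le> u x" for x
    unfolding u_def using SUP_upper[of 0 UNIV "\<lambda>n. U n x"] by (simp add: U0)
  moreover have "u x \<le> v x" for x
    unfolding u_def by (rule SUP_least) (rule Uv)
  moreover have "u \<in> borel_measurable borel"
    unfolding u_def by measurable
  ultimately show ?thesis by blast
qed

lemma ennreal_divide_mult_le:
  assumes "0 < k" "a \<le> ennreal k * b"
  shows "ennreal (1 / k) * a \<le> b"
proof -
  have "ennreal (1 / k) * a \<le> ennreal (1 / k) * (ennreal k * b)"
    by (intro mult_left_mono assms) auto
  also have "\<dots> = b" using assms(1) by (simp add: mult.assoc[symmetric] flip: ennreal_mult)
  finally show ?thesis .
qed

text \<open>With a = p - 1 this says \<gamma> q e + 1 = \<gamma>: taking the power q, then the Wolff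
  power 1/a, and gaining one factor S reproduces the power S^\<gamma>.\<close>

lemma sublinear_exponent:
  fixes a q :: real
  assumes "0 < a" "q < a"
  shows "a / (a - q) * q * (1 / a) + 1 = a / (a - q)"
  using assms by (simp add: divide_simps)

text \<open>The density is at most a multiple of \<Lambda>^q (r^q + S^s) with s = \<gamma> q. The
  moment bound estimates its mass on balls by \<Lambda>^q (1 + S(x)^s) times M-mass, and the sum
  over scales gives \<Lambda>^(qe) (1 + S^s)^e S, comparable to at most r + S^\<gamma>. K is fixed
  before \<Lambda>, so that \<Lambda> may later be chosen in terms of K.\<close>

lemma wolff_super_bound:
  fixes d e p q \<alpha> r A' \<gamma> :: real and c :: int
  assumes p: "1 < p" and q: "0 < q" "q < p - 1"
    and d: "d = real DIM('a::euclidean_space) - \<alpha> * p" "0 < d" and e: "e = 1 / (p - 1)"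
    and \<gamma>: "\<gamma> = (p - 1) / (p - 1 - q)" and r: "0 < r" and A': "0 \<le> A'" and c: "1 \<le> c"
  shows "\<exists>K>0. \<forall>(M :: 'a measure) \<Lambda> x. sigma_finite_measure M \<longrightarrow> sets M = sets borel \<longrightarrow>
     dlow_moment_le d e M (\<gamma> * q) A' c \<longrightarrow> 0 < \<Lambda> \<longrightarrow>
     wolff \<alpha> p (density M (\<lambda>y. (ennreal \<Lambda> * (ennreal r + dpot d e M y powe \<gamma>)) powe q)) x
       \<le> ennreal (K * \<Lambda> powr (q * e)) * (ennreal r + dpot d e M x powe \<gamma>)"
proof -
  define s where "s = \<gamma> * q"
  \<comment> \<open>K2 is the moment constant, K3 bounds the density on balls, and K4 compares (1 +
    S^s)^e S with r + S^\<gamma>; K collects them with the passage from dyadic sum to Wolff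
    potential.\<close>
  define K2 where "K2 = 2 powr s * (A' + 2 powr (d * e * s))"
  define K3 where "K3 = 2 powr q * (r powr q + K2)"
  define K4 where "K4 = 2 powr e * 2 * (1 + 1 / r)"
  define K where "K = 2 powr (d * e) * (K3 powr e * 2 powr (d * c * e) * K4)"
  have e0: "0 < e" using p e by simp
  have g1: "1 < \<gamma>" using q unfolding \<gamma> by simp
  have s0: "0 < s" using g1 q by (simp add: s_def)
  have se: "s * e + 1 = \<gamma>" using sublinear_exponent[of "p - 1" q] p q unfolding s_def \<gamma> e by linarith
  have K2: "0 < K2" using A' by (simp add: K2_def add_nonneg_pos)
  then have K3: "0 < K3" using r by (simp add: K3_def add_nonneg_pos)
  have K4: "0 < K4" using r by (simp add: K4_def add_pos_pos)
  have K: "0 < K" using K3 K4 by (simp add: K_def)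
  show ?thesis
  proof (intro exI[of _ K] conjI K allI impI)
    fix M :: "'a measure" and \<Lambda> :: real and x :: 'a
    assume sf: "sigma_finite_measure M" and M [measurable_cong]: "sets M = sets borel"
      and mom: "dlow_moment_le d e M (\<gamma> * q) A' c" and L: "0 < \<Lambda>"
    note [measurable] = borel_measurable_dterm[OF sf M]
    have [measurable]: "(\<lambda>y. dpot d e M y) \<in> borel_measurable borel"
      by (intro borel_measurable_zsum) measurable
    define S where "S y = dpot d e M y" for y
    have [measurable]: "S \<in> borel_measurable borel" unfolding S_def by measurable
    define g where "g y = (ennreal \<Lambda> * (ennreal r + S y powe \<gamma>)) powe q" for y
    have [measurable]: "g \<in> borel_measurable borel" unfolding g_def by measurable
    let ?m = "\<lambda>k::int. emeasure M (ball x (2 powr k))"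
    have gle: "g y \<le> ennreal (\<Lambda> powr q * 2 powr q) * (ennreal (r powr q) + S y powe s)" for y
    proof -
      have "g y = ennreal (\<Lambda> powr q) * (ennreal r + S y powe \<gamma>) powe q"
        unfolding g_def powe_mult using L by (simp add: powe_ennreal)
      also have "\<dots> \<le> ennreal (\<Lambda> powr q) * (ennreal (2 powr q) * (ennreal r powe q + (S y powe \<gamma>) powe q))"
        using q by (intro mult_left_mono powe_add_le) auto
      finally show ?thesis
        using r by (simp add: powe_ennreal powe_powe s_def ennreal_mult mult.assoc)
    qed
    have ball: "emeasure (density M g) (ball x (2 powr k)) \<le> ennreal (\<Lambda> powr q * K3) * (1 + S x powe s) * ?m (k + c)"
      for k :: int
    proof -
      let ?B = "indicator (ball x (2 powr k)) :: 'a \<Rightarrow> ennreal"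
      have mk: "?m k \<le> (1 + S x powe s) * ?m (k + c)"
      proof -
        have "?m k \<le> ?m (k + c)"
          using c by (intro emeasure_mono subset_ball powr_mono) (auto simp: M)
        also have "\<dots> \<le> (1 + S x powe s) * ?m (k + c)"
          using mult_right_mono[of 1 "1 + S x powe s" "?m (k + c)"] by simp
        finally show ?thesis .
      qed
      have "emeasure (density M g) (ball x (2 powr k)) = (\<integral>\<^sup>+ y. g y * ?B y \<partial>M)"
        by (rule emeasure_density_ball[OF M]) measurable
      also have "\<dots> \<le> (\<integral>\<^sup>+ y. ennreal (\<Lambda> powr q * 2 powr q) * (ennreal (r powr q) * ?B y + S y powe s * ?B y) \<partial>M)"
        using gle by (intro nn_integral_mono) (auto simp: indicator_def)
      also have "\<dots> = ennreal (\<Lambda> powr q * 2 powr q) * (ennreal (r powr q) * ?m k + (\<integral>\<^sup>+ y. S y powe s * ?B y \<partial>M))"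
        by (subst nn_integral_cmult, measurable, subst nn_integral_add, measurable, subst nn_integral_cmult_indicator)
           (auto simp: M)
      also have "\<dots> \<le> ennreal (\<Lambda> powr q * 2 powr q) * (ennreal (r powr q) * ((1 + S x powe s) * ?m (k + c))
          + ennreal K2 * (1 + S x powe s) * ?m (k + c))"
        using dpot_moment_ball_dpot[OF sf M less_imp_le[OF e0] s0 A' c mom[folded s_def], of x k] mk
        unfolding S_def[symmetric] K2_def[symmetric]
        by (intro mult_left_mono add_mono) auto
      also have "\<dots> = ennreal (\<Lambda> powr q * K3) * (1 + S x powe s) * ?m (k + c)"
        using K2 unfolding K3_def by (simp add: ennreal_mult distrib_left distrib_right mult_ac)
      finally show ?thesis .
    qed
    have each: "dterm d e (density M g) k x
        \<le> ennreal (\<Lambda> powr (q * e) * K3 powr e * 2 powr (d * c * e)) * (1 + S x powe s) powe e * dterm d e M (k + c) x"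
      for k
    proof -
      have "dterm d e (density M g) k x
        \<le> (ennreal (\<Lambda> powr q * K3) * (1 + S x powe s) * ?m (k + c) * ennreal (2 powr (- (d * k)))) powe e"
        unfolding dterm_def using e0 by (intro powe_mono mult_right_mono ball) auto
      also have "\<dots> = ennreal ((\<Lambda> powr q * K3) powr e) * (1 + S x powe s) powe e * (?m (k + c) powe e * ennreal (2 powr (- (d * k * e))))"
        using K3 by (simp add: powe_mult powe_ennreal powr_powr mult_ac)
      also have "(\<Lambda> powr q * K3) powr e = \<Lambda> powr (q * e) * K3 powr e"
        using K3 by (simp add: powr_mult powr_powr)
      also have "?m (k + c) powe e * ennreal (2 powr (- (d * k * e))) = ennreal (2 powr (d * c * e)) * dterm d e M (k + c) x"
      proof -
        have *: "- (d * k * e) = d * c * e + - (d * (k + c) * e)" by (simp add: algebra_simps)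
        show ?thesis unfolding dterm_eq * powr_add by (simp add: ennreal_mult mult_ac)
      qed
      finally show ?thesis by (simp add: ennreal_mult mult_ac)
    qed
    have "dpot d e (density M g) x \<le> zsum (\<lambda>k. ennreal (\<Lambda> powr (q * e) * K3 powr e * 2 powr (d * c * e)) * (1 + S x powe s) powe e * dterm d e M (k + c) x)"
      by (intro zsum_mono each)
    also have "\<dots> = ennreal (\<Lambda> powr (q * e) * K3 powr e * 2 powr (d * c * e)) * ((1 + S x powe s) powe e * S x)"
      unfolding zsum_cmult S_def by (subst zsum_shift) (simp add: mult.assoc)
    also have "(1 + S x powe s) powe e * S x \<le> ennreal K4 * (ennreal r + S x powe \<gamma>)"
    proof -
      \<comment> \<open>The positive r on the right dominates the constant 1; this is the source of
        the factor 1/r in K4.\<close>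
      have one: "1 + S x powe \<gamma> \<le> ennreal (1 + 1 / r) * (ennreal r + S x powe \<gamma>)"
      proof -
        have "1 + S x powe \<gamma> \<le> ennreal ((1 + 1 / r) * r) + ennreal (1 + 1 / r) * S x powe \<gamma>"
        proof (intro add_mono)
          show "1 \<le> ennreal ((1 + 1 / r) * r)" using r by (simp add: distrib_right)
          show "S x powe \<gamma> \<le> ennreal (1 + 1 / r) * S x powe \<gamma>"
            using mult_right_mono[of 1 "ennreal (1 + 1 / r)" "S x powe \<gamma>"] r by simp
        qed
        also have "\<dots> = ennreal (1 + 1 / r) * (ennreal r + S x powe \<gamma>)"
          using r by (simp only: distrib_left ennreal_mult add_nonneg_nonneg zero_le_divide_1_iff less_imp_le zero_le_one)
        finally show ?thesis .
      qed
      have "(1 + S x powe s) powe e * S x \<le> ennreal (2 powr e) * (1 powe e + (S x powe s) powe e) * S x"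
        using e0 by (intro mult_right_mono powe_add_le) auto
      also have "\<dots> = ennreal (2 powr e) * (S x + S x powe (s * e + 1))"
        by (simp add: powe_powe powe_plus distrib_left distrib_right mult_ac)
      also have "\<dots> \<le> ennreal (2 powr e) * ((1 + S x powe \<gamma>) + (1 + S x powe \<gamma>))"
        using powe_le_one_add[of 1 \<gamma> "S x"] g1 unfolding se
        by (intro mult_left_mono add_mono) (auto simp: add_increasing)
      also have "\<dots> = ennreal (2 powr e * 2) * (1 + S x powe \<gamma>)"
      proof -
        have "(1 + S x powe \<gamma>) + (1 + S x powe \<gamma>) = ennreal 2 * (1 + S x powe \<gamma>)"
          by (simp only: ennreal_numeral mult_2)
        then show ?thesis by (simp only: ennreal_mult powr_ge_zero zero_le_numeral mult.assoc)
      qed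
      also have "\<dots> \<le> ennreal (2 powr e * 2) * (ennreal (1 + 1 / r) * (ennreal r + S x powe \<gamma>))"
        by (intro mult_left_mono one) auto
      also have "\<dots> = ennreal K4 * (ennreal r + S x powe \<gamma>)"
      proof -
        have "ennreal K4 = ennreal (2 powr e * 2) * ennreal (1 + 1 / r)"
          unfolding K4_def using r by (intro ennreal_mult) auto
        then show ?thesis by (simp only: mult.assoc)
      qed
      finally show ?thesis .
    qed
    finally have D: "dpot d e (density M g) x
       \<le> ennreal (\<Lambda> powr (q * e) * K3 powr e * 2 powr (d * c * e)) * (ennreal K4 * (ennreal r + S x powe \<gamma>))"
      by (simp add: mult_left_mono)
    have "wolff \<alpha> p (density M g) x \<le> ennreal (2 powr (d * e)) * dpot d e (density M g) x"
      using d e e0 by (intro wolff_le_dpot) (auto simp: M)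
    also have "\<dots> \<le> ennreal (2 powr (d * e)) * (ennreal (\<Lambda> powr (q * e) * K3 powr e * 2 powr (d * c * e)) * (ennreal K4 * (ennreal r + S x powe \<gamma>)))"
      by (intro mult_left_mono D) auto
    also have "\<dots> = ennreal (K * \<Lambda> powr (q * e)) * (ennreal r + S x powe \<gamma>)"
      unfolding K_def using K4 K3 by (simp add: ennreal_mult mult_ac)
    finally show "wolff \<alpha> p (density M (\<lambda>y. (ennreal \<Lambda> * (ennreal r + dpot d e M y powe \<gamma>)) powe q)) x
       \<le> ennreal (K * \<Lambda> powr (q * e)) * (ennreal r + dpot d e M x powe \<gamma>)"
      unfolding g_def S_def .
  qed
qed

text \<open>\<open>dpot_density_ge\<close> with s = \<gamma> q reproduces S^\<gamma>, and
  homogeneity of degree e in the measure turns \<epsilon>^q into \<epsilon>^(qe).\<close>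

lemma wolff_sub_bound:
  fixes M :: "'a::euclidean_space measure" and d e p q \<alpha> \<gamma> \<epsilon> :: real
  assumes sf: "sigma_finite_measure M" and M [measurable_cong]: "sets M = sets borel"
    and p: "1 < p" and q: "0 < q" "q < p - 1"
    and d: "d = real DIM('a) - \<alpha> * p" "0 < d" and e: "e = 1 / (p - 1)"
    and \<gamma>: "\<gamma> = (p - 1) / (p - 1 - q)" and \<epsilon>: "0 \<le> \<epsilon>"
  shows "ennreal (\<epsilon> powr (q * e) * (2 powr (- (1 + d * e)) / (2 powr (d * e * (\<gamma> * q) * e) * \<gamma>))) * dpot d e M x powe \<gamma>
     \<le> wolff \<alpha> p (density M (\<lambda>y. (ennreal \<epsilon> * dpot d e M y powe \<gamma>) powe q)) x"
proof -
  note [measurable] = borel_measurable_dterm[OF sf M]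
  have [measurable]: "(\<lambda>y. dpot d e M y) \<in> borel_measurable borel"
    by (intro borel_measurable_zsum) measurable
  have e0: "0 < e" using p e by simp
  have g1: "1 < \<gamma>" using q unfolding \<gamma> by simp
  have se: "\<gamma> * q * e + 1 = \<gamma>" using sublinear_exponent[of "p - 1" q] p q unfolding \<gamma> e by linarith
  let ?K = "2 powr (d * e * (\<gamma> * q) * e) * \<gamma>"
  let ?c = "2 powr (- (1 + d * e))"
  let ?D = "dpot d e (density M (\<lambda>y. dpot d e M y powe (\<gamma> * q))) x"
  have "ennreal (1 / ?K) * dpot d e M x powe \<gamma> \<le> ?D"
    using dpot_density_ge[OF sf M d(2) e0, of "\<gamma> * q" x] g1 q unfolding se
    by (intro ennreal_divide_mult_le) auto
  then have "ennreal (\<epsilon> powr (q * e) * ?c) * (ennreal (1 / ?K) * dpot d e M x powe \<gamma>) \<le> ennreal (\<epsilon> powr (q * e) * ?c) * ?D"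
    by (intro mult_left_mono) auto
  also have "\<dots> = ennreal ?c * ((ennreal (\<epsilon> powr q)) powe e * ?D)"
    by (simp add: ennreal_mult powe_ennreal powr_powr mult_ac)
  also have "ennreal (\<epsilon> powr q) powe e * ?D
     = dpot d e (density M (\<lambda>y. ennreal (\<epsilon> powr q) * dpot d e M y powe (\<gamma> * q))) x"
    by (rule dpot_density_cmult[OF M, symmetric]) measurable
  also have "(\<lambda>y. ennreal (\<epsilon> powr q) * dpot d e M y powe (\<gamma> * q)) = (\<lambda>y. (ennreal \<epsilon> * dpot d e M y powe \<gamma>) powe q)"
    using \<epsilon> by (simp add: powe_mult powe_powe powe_ennreal)
  also have "ennreal ?c * dpot d e (density M (\<lambda>y. (ennreal \<epsilon> * dpot d e M y powe \<gamma>) powe q)) x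
     \<le> wolff \<alpha> p (density M (\<lambda>y. (ennreal \<epsilon> * dpot d e M y powe \<gamma>) powe q)) x"
    using d e e0 by (intro wolff_ge_dpot) (auto simp: M)
  finally show ?thesis
    using g1 by (simp add: ennreal_mult'[symmetric] mult.assoc[symmetric])
qed

lemma sigma_finite_measure_compact_finite:
  fixes M :: "'a::euclidean_space measure"
  assumes M: "sets M = sets borel" and fin: "\<And>K. compact K \<Longrightarrow> emeasure M K < \<infinity>"
  shows "sigma_finite_measure M"
proof
  let ?A = "range (\<lambda>n::nat. cball (0::'a) (real n))"
  have "x \<in> \<Union>?A" for x :: 'a
    using real_arch_simple[of "norm x"] by auto
  then show "\<exists>A. countable A \<and> A \<subseteq> sets M \<and> \<Union>A = space M \<and> (\<forall>a\<in>A. emeasure M a \<noteq> \<infinity>)"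
    using fin sets_eq_imp_space_eq[OF M]
    by (intro exI[of _ ?A]) (auto simp: M less_top[symmetric])
qed

text \<open>A ball about 0 covers K. On it the potential splits into a truncated part with finite
  moment and the tail at 0, which is finite by assumption.\<close>

lemma dpot_moment_compact_finite:
  fixes M :: "'a::euclidean_space measure" and d e s A' :: real and c :: int
  assumes sf: "sigma_finite_measure M" and M [measurable_cong]: "sets M = sets borel"
    and fin: "\<And>K. compact K \<Longrightarrow> emeasure M K < \<infinity>"
    and e: "0 \<le> e" and s: "0 < s" and A': "0 \<le> A'"
    and mom: "dlow_moment_le d e M s A' c" and tail: "dtail d e M 0 0 < top"
    and K: "compact K"
  shows "(\<integral>\<^sup>+ y\<in>K. dpot d e M y powe s \<partial>M) < \<infinity>"
proof -
  obtain R where R: "\<And>x. x \<in> K \<Longrightarrow> norm x \<le> R"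
    using compact_imp_bounded[OF K] by (auto simp: bounded_iff)
  \<comment> \<open>A natural k makes the tail from k + 1 on a part of the tail from 0 on.\<close>
  obtain k :: nat where k: "R < 2 ^ k" using real_arch_pow[of 2 R] by auto
  then have sub: "K \<subseteq> ball 0 (2 powr int k)" using R by (force simp: powr_realpow)
  have ballfin: "emeasure M (ball 0 t) < top" for t
  proof -
    have "emeasure M (ball 0 t) \<le> emeasure M (cball 0 t)" by (intro emeasure_mono) (auto simp: M)
    also have "\<dots> < \<infinity>" by (rule fin) simp
    finally show ?thesis by simp
  qed
  have "dtail d e M (int k + 1) 0 \<le> dtail d e M 0 0"
    by (intro zsum_mono) (auto simp: indicator_def)
  then have "dtail d e M (int k + 1) 0 < top" using tail by (rule le_less_trans)
  then have tk: "dtail d e M (int k + 1) 0 powe s < top" by (rule powe_less_top)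
  have "(\<integral>\<^sup>+ y\<in>K. dpot d e M y powe s \<partial>M) \<le> (\<integral>\<^sup>+ y. dpot d e M y powe s * indicator (ball 0 (2 powr int k)) y \<partial>M)"
    using sub by (intro nn_integral_mono) (auto simp: indicator_def)
  also have "\<dots> \<le> ennreal (2 powr s) * (ennreal A' * emeasure M (ball 0 (2 powr (int k + c))) +
        ennreal (2 powr (d * e * s)) * dtail d e M (int k + 1) 0 powe s * emeasure M (ball 0 (2 powr int k)))"
    by (rule dpot_moment_ball[OF sf M e s A' mom])
  also have "\<dots> < top"
    using tk ballfin by (simp add: ennreal_mult_less_top)
  finally show ?thesis by simp
qed

section \<open>Choice of the constants and construction of the solution\<close>

theorem theorem3p1:
  fixes p q \<alpha> C r :: real
  assumes "0 < r" and "1 < p" and "p < real DIM('a::euclidean_space)"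
    and "0 < q" and "q < p - 1" and "0 < \<alpha>" and "\<alpha> < real DIM('a) / p" and "0 < C"
  shows "\<exists>c>0. \<forall>\<sigma> :: 'a measure.
     sets \<sigma> = sets borel
     \<and> (\<forall>K. compact K \<longrightarrow> emeasure \<sigma> K < \<infinity>)
     \<and> (\<forall>E. compact E \<longrightarrow> emeasure \<sigma> E \<le> ennreal C * cap \<alpha> p E)
     \<and> (\<integral>\<^sup>+ t. indicator {1..} t *
          ((emeasure \<sigma> (ball 0 t) / ennreal (t powr (real DIM('a) - \<alpha> * p))) powe (1 / (p - 1)))
          / ennreal t \<partial>lborel) < \<infinity>
     \<longrightarrow> (\<exists>u :: 'a \<Rightarrow> ennreal.
           u \<in> borel_measurable borel
         \<and> (\<forall>x. 0 < u x)
         \<and> (\<forall>K. compact K \<longrightarrow> (\<integral>\<^sup>+ x\<in>K. u x powe q \<partial>\<sigma>) < \<infinity>)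
         \<and> (\<forall>x. u x = wolff \<alpha> p (density \<sigma> (\<lambda>y. u y powe q)) x + ennreal r)
         \<and> (\<forall>x. ennreal (1 / c) * (ennreal r + wolff \<alpha> p \<sigma> x powe ((p - 1) / (p - 1 - q))) \<le> u x
              \<and> u x \<le> ennreal c * (ennreal r + wolff \<alpha> p \<sigma> x powe ((p - 1) / (p - 1 - q))))
         \<and> (\<forall>s>0. \<forall>K. compact K \<longrightarrow> (\<integral>\<^sup>+ x\<in>K. u x powe s \<partial>\<sigma>) < \<infinity>))"
proof -
  define d where "d = real DIM('a) - \<alpha> * p"
  define e where "e = 1 / (p - 1)"
  define \<gamma> where "\<gamma> = (p - 1) / (p - 1 - q)"
  have p: "1 < p" and q: "0 < q" "q < p - 1" and r: "0 < r" by fact+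
  have d0: "0 < d"
    using assms unfolding d_def by (simp add: field_simps)
  have e0: "0 < e" using p by (simp add: e_def)
  have g1: "1 < \<gamma>" using q unfolding \<gamma>_def by simp
  have qe: "0 < q * e" "q * e < 1" using p q by (auto simp: e_def field_simps)
  have gqe: "\<gamma> * q * e + 1 = \<gamma>"
    using sublinear_exponent[of "p - 1" q] p q unfolding \<gamma>_def e_def by linarith
  have alpha: "\<alpha> < real DIM('a)"
  proof -
    have "\<alpha> * 1 < \<alpha> * p" using assms by (intro mult_strict_left_mono) auto
    then show ?thesis using d0 d_def by simp
  qed
  obtain A where A: "0 < A" and
    energy: "\<And>N :: 'a measure. finite_measure N \<Longrightarrow> sets N = sets borel \<Longrightarrow>
        (\<forall>E. compact E \<longrightarrow> emeasure N E \<le> ennreal C * cap \<alpha> p E) \<Longrightarrow>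
        (\<integral>\<^sup>+ x. dpot d e N x \<partial>N) \<le> ennreal A * emeasure N (space N)"
    using energy_le_mass[OF p \<open>0 < \<alpha>\<close> alpha d_def d0 e_def \<open>0 < C\<close>] by blast
  have "0 < \<gamma> * q" using g1 q by simp
  from dlow_moment_le_powe[OF d0 e0 A this] obtain A' c where A': "0 < A'" and c: "1 \<le> c" and
    mom: "\<And>M :: 'a measure. sigma_finite_measure M \<Longrightarrow> sets M = sets borel \<Longrightarrow>
      dlow_moment_le d e M 1 A 1 \<Longrightarrow> dlow_moment_le d e M (\<gamma> * q) A' c"
    by blast
  obtain K where K: "0 < K" and
    super: "\<And>(M :: 'a measure) \<Lambda> x. sigma_finite_measure M \<Longrightarrow> sets M = sets borel \<Longrightarrow>
     dlow_moment_le d e M (\<gamma> * q) A' c \<Longrightarrow> 0 < \<Lambda> \<Longrightarrow>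
     wolff \<alpha> p (density M (\<lambda>y. (ennreal \<Lambda> * (ennreal r + dpot d e M y powe \<gamma>)) powe q)) x
       \<le> ennreal (K * \<Lambda> powr (q * e)) * (ennreal r + dpot d e M x powe \<gamma>)"
    using wolff_super_bound[OF p q d_def d0 e_def \<gamma>_def r less_imp_le[OF A'] c] by blast
  \<comment> \<open>Since 1 - q e = 1/\<gamma>, this solves (K + 1) \<Lambda>^(qe) = \<Lambda>.
    Sublinearity, in the form q e < 1, is what makes such a multiple exist.\<close>
  define \<Lambda> where "\<Lambda> = (K + 1) powr \<gamma>"
  have L1: "1 \<le> \<Lambda>" unfolding \<Lambda>_def using K g1 by (intro ge_one_powr_ge_zero) auto
  have LK: "K * \<Lambda> powr (q * e) + 1 \<le> \<Lambda>"
  proof -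
    have "1 \<le> \<Lambda> powr (q * e)" using L1 qe by (intro ge_one_powr_ge_zero) auto
    then have "K * \<Lambda> powr (q * e) + 1 \<le> (K + 1) * \<Lambda> powr (q * e)"
      by (simp add: algebra_simps)
    also have "(K + 1) * \<Lambda> powr (q * e) = (K + 1) powr (1 + \<gamma> * (q * e))"
      unfolding \<Lambda>_def powr_powr powr_add using K by simp
    also have "1 + \<gamma> * (q * e) = \<gamma>" using gqe by (simp add: algebra_simps)
    finally show ?thesis unfolding \<Lambda>_def .
  qed
  define c1 where "c1 = 2 powr (- (1 + d * e))"
  define c2 where "c2 = 2 powr (d * e)"
  define K' where "K' = c1 / (2 powr (d * e * (\<gamma> * q) * e) * \<gamma>)"
  \<comment> \<open>By the same exponent identity \<epsilon> satisfies \<epsilon>^(qe) K' =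
    \<epsilon>, so the lower bound reproduces \<epsilon> S^\<gamma> exactly. K' \<le> 1 gives
    \<epsilon> \<le> 1, which places w below v.\<close>
  define \<epsilon> where "\<epsilon> = K' powr \<gamma>"
  have c1: "0 < c1" "c1 \<le> 1" "0 < c2"
    using powr_mono[of "- (1 + d * e)" 0 2] mult_pos_pos[OF d0 e0] by (auto simp: c1_def c2_def)
  have K': "0 < K'" "K' \<le> 1"
  proof -
    have "1 * 1 \<le> 2 powr (d * e * (\<gamma> * q) * e) * \<gamma>"
      using d0 e0 g1 q by (intro mult_mono ge_one_powr_ge_zero) auto
    then show "K' \<le> 1" "0 < K'" using c1 g1 unfolding K'_def by (auto simp: divide_le_eq)
  qed
  have eps: "0 < \<epsilon>" "\<epsilon> \<le> 1" unfolding \<epsilon>_def using K' g1 by (auto intro: powr_le1)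
  have epsK: "\<epsilon> powr (q * e) * K' = \<epsilon>"
  proof -
    have "\<epsilon> powr (q * e) * K' = K' powr (\<gamma> * (q * e) + 1)"
      unfolding \<epsilon>_def powr_powr powr_add using K' by simp
    also have "\<gamma> * (q * e) + 1 = \<gamma>" using gqe by (simp add: algebra_simps)
    finally show ?thesis unfolding \<epsilon>_def .
  qed
  \<comment> \<open>The sum of all lower bounds required of the final constant; every summand is
    fixed before the measure.\<close>
  define B where "B = 1 + \<Lambda> + \<Lambda> * c1 powr (- \<gamma>) + c2 powr \<gamma> / \<epsilon>"
  have B: "1 \<le> B" "\<Lambda> \<le> B" "\<Lambda> * c1 powr (- \<gamma>) \<le> B" "c2 powr \<gamma> / \<epsilon> \<le> B"
    using L1 eps by (auto simp: B_def add_increasing)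
  show ?thesis
    unfolding \<gamma>_def[symmetric]
  proof (intro exI[of _ B] conjI allI impI)
    show "0 < B" using B by simp
    fix M :: "'a measure"
    assume H: "sets M = sets borel
     \<and> (\<forall>K. compact K \<longrightarrow> emeasure M K < \<infinity>)
     \<and> (\<forall>E. compact E \<longrightarrow> emeasure M E \<le> ennreal C * cap \<alpha> p E)
     \<and> (\<integral>\<^sup>+ t. indicator {1..} t *
          ((emeasure M (ball 0 t) / ennreal (t powr (real DIM('a) - \<alpha> * p))) powe (1 / (p - 1)))
          / ennreal t \<partial>lborel) < \<infinity>"
    then have M [measurable_cong]: "sets M = sets borel"
      and fin: "\<And>K. compact K \<Longrightarrow> emeasure M K < \<infinity>"
      and cap: "\<And>E. compact E \<Longrightarrow> emeasure M E \<le> ennreal C * cap \<alpha> p E"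
      by blast+
    have sf: "sigma_finite_measure M" by (rule sigma_finite_measure_compact_finite[OF M fin])
    have mom1: "dlow_moment_le d e M 1 A 1"
    proof (rule dlow_moment_leI, unfold powe_one_right)
      fix z :: 'a and k :: int
      show "(\<integral>\<^sup>+ y. dlow d e M k y * indicator (ball z (2 powr k)) y \<partial>M)
        \<le> ennreal A * emeasure M (ball z (2 powr (k + 1)))"
        by (rule local_energy[where C = C and \<alpha> = \<alpha> and p = p])
           (use M fin cap energy e0 in \<open>auto simp only: less_imp_le\<close>)
    qed
    have tail: "dtail d e M 0 0 < top"
    proof -
      have "(\<integral>\<^sup>+ t. indicator {1..} t * wkern d e M 0 t \<partial>lborel)
        = (\<integral>\<^sup>+ t. indicator {1..} t *
          ((emeasure M (ball 0 t) / ennreal (t powr (real DIM('a) - \<alpha> * p))) powe (1 / (p - 1)))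
          / ennreal t \<partial>lborel)"
        unfolding wkern_def d_def e_def by (intro nn_integral_cong) (simp add: indicator_def)
      also have "\<dots> < top" using H by simp
      finally have "ennreal c1 * dtail d e M 0 0 < top"
        using tail_dpot_le[OF M d0 e0, of 0] unfolding c1_def by (rule le_less_trans[rotated])
      then show ?thesis using c1 by (auto simp: ennreal_mult_less_top)
    qed
    note [measurable] = borel_measurable_dterm[OF sf M]
    have [measurable]: "(\<lambda>y. dpot d e M y) \<in> borel_measurable borel"
      by (intro borel_measurable_zsum) measurable
    define w where "w y = ennreal r + ennreal \<epsilon> * dpot d e M y powe \<gamma>" for y
    define v where "v y = ennreal \<Lambda> * (ennreal r + dpot d e M y powe \<gamma>)" for y
    have wm [measurable]: "w \<in> borel_measurable borel" unfolding w_def by measurable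
    have vm [measurable]: "v \<in> borel_measurable borel" unfolding v_def by measurable
    have wv: "w y \<le> v y" for y
    proof -
      have "w y \<le> 1 * (ennreal r + dpot d e M y powe \<gamma>)"
        unfolding w_def using eps mult_right_mono[of "ennreal \<epsilon>" 1 "dpot d e M y powe \<gamma>"]
        by (simp add: add_left_mono)
      also have "\<dots> \<le> v y" unfolding v_def using L1 by (intro mult_right_mono) auto
      finally show ?thesis .
    qed
    \<comment> \<open>Dropping r inside the density only decreases the potential, and
      \<open>wolff_sub_bound\<close> handles the remaining \<epsilon> S^\<gamma>.\<close>
    have sub: "w x \<le> wolff \<alpha> p (density M (\<lambda>y. w y powe q)) x + ennreal r" for x
    proof -
      have "ennreal \<epsilon> * dpot d e M x powe \<gamma>
         \<le> wolff \<alpha> p (density M (\<lambda>y. (ennreal \<epsilon> * dpot d e M y powe \<gamma>) powe q)) x"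
        using wolff_sub_bound[OF sf M p q d_def d0 e_def \<gamma>_def less_imp_le[OF eps(1)], of x]
        unfolding c1_def[symmetric] K'_def[symmetric] epsK .
      also have "\<dots> \<le> wolff \<alpha> p (density M (\<lambda>y. w y powe q)) x"
        using q unfolding w_def by (intro wolff_density_mono[OF M p] powe_mono) auto
      finally show ?thesis by (simp add: w_def add.commute add_right_mono)
    qed
    \<comment> \<open>The added r is absorbed as one more copy of r + S^\<gamma>, which is why
      \<open>LK\<close> carries the summand 1.\<close>
    have sup: "wolff \<alpha> p (density M (\<lambda>y. v y powe q)) x + ennreal r \<le> v x" for x
    proof -
      let ?z = "ennreal r + dpot d e M x powe \<gamma>"
      have "wolff \<alpha> p (density M (\<lambda>y. v y powe q)) x + ennreal r \<le> ennreal (K * \<Lambda> powr (q * e)) * ?z + 1 * ?z"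
        unfolding v_def using super[OF sf M mom[OF sf M mom1], of \<Lambda> x] L1 by (intro add_mono) auto
      also have "\<dots> = ennreal (K * \<Lambda> powr (q * e) + 1) * ?z"
        using K by (simp add: distrib_right)
      also have "\<dots> \<le> v x" unfolding v_def by (intro mult_right_mono ennreal_leI LK) auto
      finally show ?thesis .
    qed
    obtain u where um [measurable]: "u \<in> borel_measurable borel"
      and wu: "\<And>x. w x \<le> u x" and uv: "\<And>x. u x \<le> v x"
      and eq: "\<And>x. u x = wolff \<alpha> p (density M (\<lambda>y. u y powe q)) x + ennreal r"
      using wolff_solution_between[OF sf M p q(1) wm vm wv sub sup] by blast
    have Wge: "ennreal c1 * dpot d e M x \<le> wolff \<alpha> p M x" for x
      unfolding c1_def by (rule wolff_ge_dpot[OF M d_def d0 e_def e0])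
    have Wle: "wolff \<alpha> p M x \<le> ennreal c2 * dpot d e M x" for x
      unfolding c2_def by (rule wolff_le_dpot[OF M d_def d0 e_def e0])
    \<comment> \<open>From u \<le> v, the s-th moment of u reduces to the moment of S of order
      \<gamma> s. These constants may depend on s, since only finiteness is claimed; s = q gives the
      local integrability required of a solution.\<close>
    have local: "(\<integral>\<^sup>+ x\<in>K. u x powe s \<partial>M) < \<infinity>" if s: "0 < s" and K: "compact K" for s K
    proof -
      have Kb [measurable]: "K \<in> sets borel" using K by (simp add: borel_compact)
      have "0 < \<gamma> * s" using g1 s by simp
      from dlow_moment_le_powe[OF d0 e0 A this] obtain A2 c2 where A2: "0 < A2"
        and mom2: "dlow_moment_le d e M (\<gamma> * s) A2 c2"
        using sf M mom1 by blast
      have F: "(\<integral>\<^sup>+ y\<in>K. dpot d e M y powe (\<gamma> * s) \<partial>M) < \<infinity>"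
        using e0 A2 \<open>0 < \<gamma> * s\<close>
        by (intro dpot_moment_compact_finite[OF sf M fin _ _ _ mom2 tail K]) auto
      let ?c = "ennreal \<Lambda> powe s * ennreal (2 powr s)"
      have "(\<integral>\<^sup>+ x\<in>K. u x powe s \<partial>M)
        \<le> (\<integral>\<^sup>+ x. ?c * (ennreal r powe s * indicator K x + dpot d e M x powe (\<gamma> * s) * indicator K x) \<partial>M)"
      proof (rule nn_integral_mono)
        fix x
        have "u x powe s \<le> v x powe s" using s by (intro powe_mono uv) auto
        also have "\<dots> = ennreal \<Lambda> powe s * (ennreal r + dpot d e M x powe \<gamma>) powe s"
          by (simp add: v_def powe_mult)
        also have "\<dots> \<le> ennreal \<Lambda> powe s * (ennreal (2 powr s) * (ennreal r powe s + (dpot d e M x powe \<gamma>) powe s))"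
          using s by (intro mult_left_mono powe_add_le) auto
        finally show "u x powe s * indicator K x
          \<le> ?c * (ennreal r powe s * indicator K x + dpot d e M x powe (\<gamma> * s) * indicator K x)"
          by (auto simp: indicator_def powe_powe mult.assoc)
      qed
      also have "\<dots> = ?c * (ennreal r powe s * emeasure M K + (\<integral>\<^sup>+ y\<in>K. dpot d e M y powe (\<gamma> * s) \<partial>M))"
        by (subst nn_integral_cmult, measurable, subst nn_integral_add, measurable, subst nn_integral_cmult_indicator)
           (auto simp: M)
      also have "\<dots> < top"
        using F fin[OF K] r L1 by (simp add: ennreal_mult_less_top powe_less_top)
      finally show ?thesis by simp
    qed
    have lower: "ennreal (1 / B) * (ennreal r + wolff \<alpha> p M x powe \<gamma>) \<le> u x" for x
    proof (rule ennreal_divide_mult_le)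
      show "0 < B" using B by simp
      have "ennreal r + wolff \<alpha> p M x powe \<gamma> \<le> ennreal B * ennreal r + ennreal B * (ennreal \<epsilon> * dpot d e M x powe \<gamma>)"
      proof (intro add_mono)
        show "ennreal r \<le> ennreal B * ennreal r"
          using mult_right_mono[of 1 "ennreal B" "ennreal r"] B by simp
        have "wolff \<alpha> p M x powe \<gamma> \<le> (ennreal c2 * dpot d e M x) powe \<gamma>"
          using g1 by (intro powe_mono Wle) auto
        also have "\<dots> = ennreal (c2 powr \<gamma> / \<epsilon>) * (ennreal \<epsilon> * dpot d e M x powe \<gamma>)"
          using c1 eps by (simp add: powe_mult powe_ennreal mult.assoc[symmetric] flip: ennreal_mult)
        also have "\<dots> \<le> ennreal B * (ennreal \<epsilon> * dpot d e M x powe \<gamma>)"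
          by (intro mult_right_mono ennreal_leI B) auto
        finally show "wolff \<alpha> p M x powe \<gamma> \<le> ennreal B * (ennreal \<epsilon> * dpot d e M x powe \<gamma>)" .
      qed
      also have "\<dots> = ennreal B * w x" by (simp add: w_def distrib_left)
      also have "\<dots> \<le> ennreal B * u x" by (intro mult_left_mono wu) auto
      finally show "ennreal r + wolff \<alpha> p M x powe \<gamma> \<le> ennreal B * u x" .
    qed
    have upper: "u x \<le> ennreal B * (ennreal r + wolff \<alpha> p M x powe \<gamma>)" for x
    proof -
      \<comment> \<open>The negative power of c1 compensates for passing from S to the possibly
        smaller Wolff potential.\<close>
      have "ennreal \<Lambda> * dpot d e M x powe \<gamma> = ennreal (\<Lambda> * c1 powr (- \<gamma>)) * (ennreal c1 * dpot d e M x) powe \<gamma>"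
      proof -
        have "\<Lambda> * c1 powr (- \<gamma>) * c1 powr \<gamma> = \<Lambda>" using c1 by (simp add: powr_minus)
        then have "ennreal \<Lambda> = ennreal (\<Lambda> * c1 powr (- \<gamma>)) * ennreal (c1 powr \<gamma>)"
          using L1 by (simp flip: ennreal_mult)
        then show ?thesis using c1 by (simp add: powe_mult powe_ennreal mult.assoc)
      qed
      also have "\<dots> \<le> ennreal B * wolff \<alpha> p M x powe \<gamma>"
        using g1 by (intro mult_mono ennreal_leI B powe_mono Wge) auto
      finally have "ennreal \<Lambda> * dpot d e M x powe \<gamma> \<le> ennreal B * wolff \<alpha> p M x powe \<gamma>" .
      moreover have "ennreal \<Lambda> * ennreal r \<le> ennreal B * ennreal r"
        by (intro mult_right_mono ennreal_leI B) auto
      ultimately have "v x \<le> ennreal B * (ennreal r + wolff \<alpha> p M x powe \<gamma>)"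
        unfolding v_def distrib_left by (rule add_mono[rotated])
      then show ?thesis using uv[of x] by simp
    qed
    have pos: "0 < u x" for x
      using eq[of x] r by (simp add: add_pos_pos zero_less_iff_neq_zero)
    show "\<exists>u :: 'a \<Rightarrow> ennreal.
           u \<in> borel_measurable borel
         \<and> (\<forall>x. 0 < u x)
         \<and> (\<forall>K. compact K \<longrightarrow> (\<integral>\<^sup>+ x\<in>K. u x powe q \<partial>M) < \<infinity>)
         \<and> (\<forall>x. u x = wolff \<alpha> p (density M (\<lambda>y. u y powe q)) x + ennreal r)
         \<and> (\<forall>x. ennreal (1 / B) * (ennreal r + wolff \<alpha> p M x powe \<gamma>) \<le> u x
              \<and> u x \<le> ennreal B * (ennreal r + wolff \<alpha> p M x powe \<gamma>))
         \<and> (\<forall>s>0. \<forall>K. compact K \<longrightarrow> (\<integral>\<^sup>+ x\<in>K. u x powe s \<partial>M) < \<infinity>)"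
      using um pos local q(1) eq lower upper by (intro exI[of _ u] conjI allI impI)
  qed
qed

end
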